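(* Let $f\in N$ with no zeros in $\mathbb{D}$ and let $a\in[0,1)$. Then $f$ is outer if and only if the set of functions \[ \{\log|(f\circ\psi)^*| : \psi\in\mathcal{S}_a\} \] is uniformly integrable on $\mathbb{T}$.
   Context: $\mathbb{D}$ is the open unit disk in $\mathbb{C}$ and $\mathbb{T}$ is the unit circle, equipped with Lebesgue (arc-length) measure. $\mathcal{S}$ denotes the set of holomorphic functions $\phi:\mathbb{D}\to\mathbb{D}$, and for $a\in[0,1)$, $\mathcal{S}_a:=\{\psi\in\mathcal{S}:|\psi(0)|\le a\}$. A holomorphic function $g:\mathbb{D}\to\mathbb{C}$ is called outer if it has the form \[ g(z)=c\exp\Bigl(\int_{\mathbb{T}} \frac{e^{i\theta}+z}{e^{i\theta}-z}\log\rho(e^{i\theta})\,\frac{d\theta}{2\pi}\Bigr)\quad(z\in\mathbb{D}), \] where $c$ is a unimodular constant and $\rho:\mathbb{T}\to\mathbb{R}^+$ is a function such that $\log\rho\in L^1(\mathbb{T})$. The Nevanlinna class $N$ consists of those functions of the form $f=f_1/f_2$, where $f_1,f_2$ are bounded and holomorphic on $\mathbb{D}$ and $f_2$ has no zeros. For $g\in N$, $g^*(e^{i\theta}):=\lim_{r\to1^-}g(re^{i\theta})$ denotes the radial boundary limit, which exists a.e. on $\mathbb{T}$. If $f\in N$ and $\psi\in\mathcal{S}$, then $f\circ\psi\in N$, so $(f\circ\psi)^*$ exists a.e. on $\mathbb{T}$. A family $\mathcal{G}$ of measurable complex-valued functions (defined a.e.) on a measure space $(X,\mu)$ is uniformly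 integrable if $\sup_{g\in\mathcal{G}}\int_{\{|g|\ge t\}}|g|\,d\mu\to0$ as $t\to\infty$. *)

theory Defs
  imports "HOL-Complex_Analysis.Complex_Analysis"
begin

abbreviation unit_disk :: "complex set" where
  "unit_disk \<equiv> ball 0 1"

abbreviation unit_circle :: "complex set" where
  "unit_circle \<equiv> sphere 0 1"

text \<open>Arc length on the unit circle, of total mass \<open>2 * pi\<close>. It is completed, so its
  measurable sets are the Lebesgue measurable subsets of the circle.\<close>

definition arc_measure :: "complex measure" where
  "arc_measure =
     completion (distr (restrict_space lborel {0..<2 * pi}) (restrict_space borel unit_circle) cis)"

definition schur_class :: "(complex \<Rightarrow> complex) set" where
  "schur_class = {\<phi>. \<phi> holomorphic_on unit_disk \<and> \<phi> ` unit_disk \<subseteq> unit_disk}"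

definition schur_class_le :: "real \<Rightarrow> (complex \<Rightarrow> complex) set" where
  "schur_class_le a = {\<psi> \<in> schur_class. norm (\<psi> 0) \<le> a}"

definition outer :: "(complex \<Rightarrow> complex) \<Rightarrow> bool" where
  "outer g \<longleftrightarrow> g holomorphic_on unit_disk \<and>
     (\<exists>c \<rho>. norm c = 1 \<and> (\<forall>\<zeta>\<in>unit_circle. \<rho> \<zeta> > (0::real)) \<and>
        integrable arc_measure (\<lambda>\<zeta>. ln (\<rho> \<zeta>)) \<and>
        (\<forall>z\<in>unit_disk.
           g z = c * exp ((LINT \<zeta>|arc_measure. (\<zeta> + z) / (\<zeta> - z) * of_real (ln (\<rho> \<zeta>)))
                          / of_real (2 * pi))))"

definition nevanlinna_class :: "(complex \<Rightarrow> complex) set" where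
  "nevanlinna_class =
     {f. \<exists>f\<^sub>1 f\<^sub>2. f\<^sub>1 holomorphic_on unit_disk \<and> bounded (f\<^sub>1 ` unit_disk) \<and>
           f\<^sub>2 holomorphic_on unit_disk \<and> bounded (f\<^sub>2 ` unit_disk) \<and>
           (\<forall>z\<in>unit_disk. f\<^sub>2 z \<noteq> 0) \<and> (\<forall>z\<in>unit_disk. f z = f\<^sub>1 z / f\<^sub>2 z)}"

text \<open>Where the limit does not exist, the value is a fixed unspecified number. For functions of
  the Nevanlinna class this happens on a null set only.\<close>

definition radial_limit :: "(complex \<Rightarrow> complex) \<Rightarrow> complex \<Rightarrow> complex" where
  "radial_limit g \<zeta> = Lim (at_left 1) (\<lambda>r. g (of_real r * \<zeta>))"

definition uniformly_integrable ::
    "'a measure \<Rightarrow> ('a \<Rightarrow> 'b::{real_normed_vector, second_countable_topology}) set \<Rightarrow> bool" where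
  "uniformly_integrable M G \<longleftrightarrow> (\<forall>g\<in>G. g \<in> borel_measurable M) \<and>
     ((\<lambda>t::real. SUP g\<in>G. \<integral>\<^sup>+x\<in>{x \<in> space M. norm (g x) \<ge> t}. ennreal (norm (g x)) \<partial>M)
        \<longlongrightarrow> 0) at_top"

end

theory Submission
  imports Defs "HOL-Probability.Helly_Selection"
begin

text \<open>Write \<open>u = log |f|\<close>, a harmonic function on the disk since \<open>f\<close> has no zeros there. Outer means that \<open>u\<close> is
the Poisson integral of an integrable function \<open>h\<close> on the circle.

Suppose first that \<open>f\<close> is outer. For a level \<open>K\<close> one has \<open>|h| \<le> K + e\<close> with \<open>e = max 0 (|h| - K)\<close>, so
\<open>|u| \<le> K + v\<close> where \<open>v\<close> is the Poisson integral of \<open>e\<close>, divided by \<open>2 * pi\<close>. For \<open>\<psi>\<close> in the class, \<open>v \<circ> \<psi>\<close> is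
a nonnegative harmonic function whose mean over every circle around \<open>0\<close> is \<open>v (\<psi> 0)\<close>, and this is at most a
constant depending only on \<open>a\<close> times the integral of \<open>e\<close>. Fatou's lemma along a sequence of radii moves
the bound to the boundary: \<open>log |(f \<circ> \<psi>)\<^sup>*| \<le> K + w\<close> in absolute value, with the integral of \<open>w\<close> uniformly
small once \<open>K\<close> is large. This is uniform integrability. At points without a radial limit,
\<open>radial_limit\<close> takes one fixed value, and where the limit is \<open>0\<close> the logarithm is \<open>ln 0 = 0\<close>; at both kinds of
points \<open>K\<close> alone is a bound. Measurability of the boundary functions is \<open>borel_measurable_radial_limit\<close>, and the
estimate rests on \<open>nn_integral_poisson_nn_le\<close> and \<open>log_boundary_le_liminf\<close>.

Conversely, the dilations \<open>\<psi> z = r * z\<close> already decide. They belong to the class for every \<open>a \<ge> 0\<close>, and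
\<open>f \<circ> \<psi>\<close> is continuous up to the boundary, so the hypothesis says that the functions \<open>u (r \<zeta>)\<close> on the
circle are uniformly integrable. Such a family is weakly relatively compact (Dunford-Pettis,
\<open>weakly_compact_of_equi_integrable\<close>): along some radii tending to \<open>1\<close> the functions \<open>u (r \<zeta>)\<close> converge weakly
to an integrable \<open>h\<close>. The Schwarz formula represents \<open>log f (r z)\<close> by the boundary values \<open>u (r \<zeta>)\<close>
(\<open>Schwarz_integral_formula\<close>). Its kernel is continuous in \<open>\<zeta>\<close>, so it passes to the weak limit and
represents \<open>log f\<close> by \<open>h\<close>, up to an imaginary constant. Therefore \<open>f\<close> is outer with \<open>\<rho> = exp h\<close>.\<close>

section \<open>Arc length and the angle parameter\<close>

text \<open>Lebesgue measure on \<open>[0, 2 * pi)\<close>, regarded as a measure on the whole line: the weak convergence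
theory below concerns Borel measures on the real line.\<close>

definition angle_measure :: "real measure" where
  "angle_measure = density lborel (indicator {0..<2 * pi})"

lemma sets_angle_measure [measurable_cong, simp]: "sets angle_measure = sets borel"
  and space_angle_measure [simp]: "space angle_measure = UNIV"
  by (simp_all add: angle_measure_def)

lemma emeasure_angle_measure_UNIV: "emeasure angle_measure UNIV = ennreal (2 * pi)"
proof -
  have "emeasure angle_measure UNIV = emeasure lborel {0..<2 * pi}"
    unfolding angle_measure_def by (subst emeasure_density) simp_all
  then show ?thesis by simp
qed

lemma finite_angle_measure: "finite_borel_measure angle_measure"
  unfolding finite_borel_measure_def finite_borel_measure_axioms_def
  by (intro conjI finite_measureI) (simp_all add: emeasure_angle_measure_UNIV)

lemma AE_angle_measure: "AE x in angle_measure. 0 \<le> x \<and> x < 2 * pi"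
  unfolding angle_measure_def by (subst AE_density) (auto simp: indicator_def)

lemma cis_measurable_circle: "cis \<in> angle_measure \<rightarrow>\<^sub>M restrict_space borel unit_circle"
  by (intro measurable_restrict_space2)
     (auto intro!: borel_measurable_continuous_onI continuous_intros simp: measurable_cong_sets[OF sets_angle_measure refl])

lemma arc_measure_eq:
  "arc_measure = completion (distr angle_measure (restrict_space borel unit_circle) cis)"
proof -
  have cis[measurable]: "cis \<in> borel \<rightarrow>\<^sub>M restrict_space borel unit_circle"
    using cis_measurable_circle by (simp add: measurable_cong_sets[OF sets_angle_measure refl])
  have "distr (restrict_space lborel {0..<2 * pi}) (restrict_space borel unit_circle) cis =
      distr angle_measure (restrict_space borel unit_circle) cis"
  proof (rule measure_eqI)
    fix A assume "A \<in> sets (distr (restrict_space lborel {0..<2 * pi}) (restrict_space borel unit_circle) cis)"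
    then have A[measurable]: "A \<in> sets (restrict_space borel unit_circle)" by simp
    have m: "cis \<in> restrict_space lborel {0..<2 * pi} \<rightarrow>\<^sub>M restrict_space borel unit_circle"
      by (intro measurable_restrict_space1) simp
    have v: "cis -` A \<in> sets borel" using measurable_sets[OF cis A] by simp
    have "emeasure (distr (restrict_space lborel {0..<2 * pi}) (restrict_space borel unit_circle) cis) A
       = emeasure lborel (cis -` A \<inter> {0..<2 * pi})"
      using m A by (simp add: emeasure_distr emeasure_restrict_space space_restrict_space)
    also have "\<dots> = emeasure angle_measure (cis -` A)"
      using v by (simp add: angle_measure_def emeasure_density nn_integral_set_ennreal indicator_inter_arith[symmetric] Int_commute)
    also have "\<dots> = emeasure (distr angle_measure (restrict_space borel unit_circle) cis) A"
      using A cis_measurable_circle by (simp add: emeasure_distr)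
    finally show "emeasure (distr (restrict_space lborel {0..<2 * pi}) (restrict_space borel unit_circle) cis) A
      = emeasure (distr angle_measure (restrict_space borel unit_circle) cis) A" .
  qed simp
  then show ?thesis by (simp add: arc_measure_def)
qed

lemma space_arc_measure [simp]: "space arc_measure = unit_circle"
  by (simp add: arc_measure_eq space_restrict_space)

lemma borel_measurable_arc_measure:
  "g \<in> borel_measurable (restrict_space borel unit_circle) \<Longrightarrow> g \<in> borel_measurable arc_measure"
  unfolding arc_measure_eq by (intro measurable_completion) simp

lemma continuous_borel_measurable_arc_measure:
  fixes g :: "complex \<Rightarrow> 'b::topological_space"
  shows "continuous_on unit_circle g \<Longrightarrow> g \<in> borel_measurable arc_measure"
  by (intro borel_measurable_arc_measure borel_measurable_continuous_on_restrict)

lemma nn_integral_arc_measure: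
  "g \<in> borel_measurable (restrict_space borel unit_circle) \<Longrightarrow>
    (\<integral>\<^sup>+\<zeta>. g \<zeta> \<partial>arc_measure) = (\<integral>\<^sup>+x. g (cis x) \<partial>angle_measure)"
  unfolding arc_measure_eq nn_integral_completion using cis_measurable_circle
  by (subst nn_integral_distr) auto

lemma
  fixes g :: "complex \<Rightarrow> 'b::{banach, second_countable_topology}"
  assumes "g \<in> borel_measurable (restrict_space borel unit_circle)"
  shows integral_arc_measure: "(\<integral>\<zeta>. g \<zeta> \<partial>arc_measure) = (\<integral>x. g (cis x) \<partial>angle_measure)"
    and integrable_arc_measure_iff:
      "integrable arc_measure g \<longleftrightarrow> integrable angle_measure (\<lambda>x. g (cis x))"
proof -
  have g': "g \<in> borel_measurable (distr angle_measure (restrict_space borel unit_circle) cis)"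
    using assms by simp
  show "(\<integral>\<zeta>. g \<zeta> \<partial>arc_measure) = (\<integral>x. g (cis x) \<partial>angle_measure)"
    unfolding arc_measure_eq integral_completion[OF g']
    by (rule integral_distr[OF cis_measurable_circle assms])
  show "integrable arc_measure g \<longleftrightarrow> integrable angle_measure (\<lambda>x. g (cis x))"
    unfolding arc_measure_eq integrable_completion[OF g']
    by (rule integrable_distr_eq[OF cis_measurable_circle assms])
qed

lemma finite_arc_measure: "finite_measure arc_measure"
proof
  interpret finite_borel_measure angle_measure by (rule finite_angle_measure)
  have "emeasure arc_measure unit_circle = (\<integral>\<^sup>+\<zeta>. 1 \<partial>arc_measure)" by simp
  also have "\<dots> = emeasure angle_measure UNIV" by (subst nn_integral_arc_measure) auto
  finally show "emeasure arc_measure (space arc_measure) \<noteq> \<infinity>" by (simp add: emeasure_angle_measure_UNIV)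
qed

lemma integral_angle_measure_continuous:
  fixes g :: "real \<Rightarrow> 'b::euclidean_space"
  assumes g: "continuous_on UNIV g"
  shows "(\<integral>x. g x \<partial>angle_measure) = integral {0..2 * pi} g"
proof -
  have d: "angle_measure = density lborel (\<lambda>x. ennreal (indicator {0..<2 * pi} x))"
    by (simp add: angle_measure_def ennreal_indicator)
  have "set_integrable lborel {0..2*pi} g"
    by (rule borel_integrable_atLeastAtMost') (rule continuous_on_subset[OF g subset_UNIV])
  then have *: "set_integrable lborel {0..<2*pi} g"
    by (rule set_integrable_subset) auto
  have "(\<integral>x. g x \<partial>angle_measure) = (LINT x:{0..<2*pi}|lborel. g x)"
    unfolding d set_lebesgue_integral_def
    by (rule integral_density) (simp_all add: borel_measurable_continuous_onI[OF g])
  also have "\<dots> = integral {0..<2*pi} g"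
    by (rule set_borel_integral_eq_integral(2)[OF *])
  also have "\<dots> = integral {0..2*pi} g"
  proof (rule integral_subset_negligible)
    show "negligible ({0..2 * pi} - {0..<2 * pi})"
      by (rule negligible_subset[of "{2 * pi}"]) auto
  qed auto
  finally show ?thesis .
qed

section \<open>The Cauchy and Schwarz formulas on the circle\<close>

text \<open>On the unit circle \<open>d\<zeta> = \<i> * \<zeta> * d\<theta>\<close>, which turns the Cauchy formula into an integral with respect to arc length
and produces the factor \<open>\<zeta>\<close> in the kernel.\<close>

lemma Cauchy_arc_measure:
  fixes g :: "complex \<Rightarrow> complex"
  assumes "continuous_on (cball 0 1) g" "g holomorphic_on ball 0 1" "norm w < 1"
  shows "(\<integral>\<zeta>. \<zeta> / (\<zeta> - w) * g \<zeta> \<partial>arc_measure) = 2 * pi * g w"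
proof -
  define k where "k x = cis x / (cis x - w) * g (cis x)" for x
  have ne: "\<zeta> \<noteq> w" if "norm \<zeta> = 1" for \<zeta> using that assms(3) by auto
  have gc: "continuous_on unit_circle g"
    by (rule continuous_on_subset[OF assms(1)]) auto
  have c: "continuous_on unit_circle (\<lambda>\<zeta>. \<zeta> / (\<zeta> - w) * g \<zeta>)"
    by (intro continuous_intros gc) (use ne in auto)
  have k: "continuous_on UNIV k" unfolding k_def
    by (intro continuous_intros continuous_on_compose2[OF gc]) (use ne[of "cis x" for x] in auto)
  have "((\<lambda>u. g u/(u-w)) has_contour_integral (2 * of_real pi * \<i> * g w)) (circlepath 0 1)"
    using assms by (intro Cauchy_integral_circlepath) auto
  then have "((\<lambda>x. \<i> * (2 * pi) * k (2 * pi * x)) has_integral (2 * of_real pi * \<i> * g w)) {0..1}"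
    unfolding has_contour_integral vector_derivative_circlepath
  proof (rule has_integral_eq[rotated])
    fix x :: real
    have e: "exp (2 * of_real pi * \<i> * of_real x) = cis (2 * pi * x)"
      by (simp add: cis_conv_exp mult_ac)
    show "g (circlepath 0 1 x) / (circlepath 0 1 x - w) * (of_real (2 * pi) * \<i> * of_real 1 * exp (2 * of_real pi * \<i> * x))
       = \<i> * (2 * pi) * k (2 * pi * x)"
      unfolding e circlepath k_def by simp
  qed
  then have "((\<lambda>x. k (2 * pi * x)) has_integral g w) {0..1}"
    using has_integral_mult_right_iff[of "\<i> * of_real (2 * pi)" "\<lambda>x. k (2 * pi * x)" "2 * of_real pi * \<i> * g w" "{0..1}"]
    by simp
  moreover have "((\<lambda>x. k (2 * pi * x)) has_integral integral {0..2*pi} k /\<^sub>R (2 * pi)) {0..1}"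
    using has_integral_affinity'[of k "integral {0..2*pi} k" 0 "2*pi" "2*pi" 0]
      integrable_continuous_interval[OF continuous_on_subset[OF k subset_UNIV], of 0 "2*pi"]
    by (auto simp: integrable_integral)
  ultimately have "integral {0..2*pi} k /\<^sub>R (2 * pi) = g w"
    by (metis has_integral_unique)
  then have "integral {0..2*pi} k = (2 * pi) *\<^sub>R g w"
    by (metis divideR_right pi_neq_zero mult_eq_0_iff zero_neq_numeral)
  then have "integral {0..2*pi} k = 2 * pi * g w"
    by (simp add: scaleR_conv_of_real)
  moreover have "(\<integral>\<zeta>. \<zeta> / (\<zeta> - w) * g \<zeta> \<partial>arc_measure) = (\<integral>x. k x \<partial>angle_measure)"
    unfolding k_def by (rule integral_arc_measure) (intro borel_measurable_continuous_on_restrict c)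
  ultimately show ?thesis using integral_angle_measure_continuous[OF k] by simp
qed

lemma mean_value_arc_measure:
  fixes g :: "complex \<Rightarrow> complex"
  assumes "continuous_on (cball 0 1) g" "g holomorphic_on ball 0 1"
  shows "(\<integral>\<zeta>. g \<zeta> \<partial>arc_measure) = 2 * pi * g 0"
proof -
  have "(\<integral>\<zeta>. g \<zeta> \<partial>arc_measure) = (\<integral>\<zeta>. \<zeta> / (\<zeta> - 0) * g \<zeta> \<partial>arc_measure)"
    by (rule Bochner_Integration.integral_cong) auto
  also have "\<dots> = 2 * pi * g 0" using assms by (rule Cauchy_arc_measure) simp
  finally show ?thesis .
qed

lemma integrable_arc_measure_continuous:
  fixes g :: "complex \<Rightarrow> 'b::{banach, second_countable_topology}"
  assumes "continuous_on unit_circle g"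
  shows "integrable arc_measure g"
proof -
  interpret finite_measure arc_measure by (rule finite_arc_measure)
  have "compact (g ` unit_circle)" by (intro compact_continuous_image assms) auto
  then obtain B where "\<forall>y\<in>g ` unit_circle. norm y \<le> B"
    using compact_imp_bounded bounded_iff by metis
  then show ?thesis
    by (intro integrable_const_bound[of _ B] continuous_borel_measurable_arc_measure assms) auto
qed

text \<open>Write \<open>Re G\<close> as half of \<open>G + cnj G\<close>. The kernel equals \<open>2 * \<zeta> / (\<zeta> - z) - 1\<close>, so the part with \<open>G\<close> follows from the
Cauchy formula. On the circle \<open>cnj \<zeta> = 1 / \<zeta>\<close>, so the part with \<open>cnj G\<close> is the conjugate of the integral of a
function that is holomorphic on the disk, and only the value of that function at \<open>0\<close> survives.\<close>

lemma Schwarz_integral_formula: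
  fixes G :: "complex \<Rightarrow> complex"
  assumes cont: "continuous_on (cball 0 1) G" and hol: "G holomorphic_on ball 0 1" and z: "norm z < 1"
  shows "(\<integral>\<zeta>. (\<zeta> + z) / (\<zeta> - z) * of_real (Re (G \<zeta>)) \<partial>arc_measure)
     = 2 * pi * (G z - \<i> * Im (G 0))"
proof -
  have gc: "continuous_on unit_circle G"
    by (rule continuous_on_subset[OF cont]) auto
  have ne: "\<zeta> \<noteq> z" if "norm \<zeta> = 1" for \<zeta> using that z by auto
  \<comment> \<open>The reflected kernel has its pole outside the closed disk.\<close>
  have ne': "1 - cnj z * \<zeta> \<noteq> 0" if "norm \<zeta> \<le> 1" for \<zeta>
  proof
    assume "1 - cnj z * \<zeta> = 0"
    then have "cnj z * \<zeta> = 1" by (metis eq_iff_diff_eq_0)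
    then have "norm (cnj z * \<zeta>) = 1" by (simp only: norm_one)
    moreover have "norm z * norm \<zeta> \<le> norm z"
      using that by (intro mult_left_le) auto
    ultimately show False using z by (simp add: norm_mult)
  qed
  have i1: "integrable arc_measure (\<lambda>\<zeta>. 2 * (\<zeta> / (\<zeta> - z) * G \<zeta>))"
       and i2: "integrable arc_measure (\<lambda>\<zeta>. (\<zeta> + z) / (\<zeta> - z) * cnj (G \<zeta>))"
    by (intro integrable_arc_measure_continuous continuous_intros gc; use ne in auto)+
  have i3: "integrable arc_measure G"
    by (intro integrable_arc_measure_continuous gc)
  have "(\<integral>\<zeta>. (\<zeta> + z) / (\<zeta> - z) * G \<zeta> \<partial>arc_measure)
      = (\<integral>\<zeta>. 2 * (\<zeta> / (\<zeta> - z) * G \<zeta>) - G \<zeta> \<partial>arc_measure)"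
  proof (rule Bochner_Integration.integral_cong)
    fix \<zeta> assume "\<zeta> \<in> space arc_measure"
    then have "\<zeta> \<noteq> z" using ne by simp
    then have "(\<zeta> + z) / (\<zeta> - z) = 2 * (\<zeta> / (\<zeta> - z)) - 1" by (simp add: divide_simps)
    then show "(\<zeta> + z) / (\<zeta> - z) * G \<zeta> = 2 * (\<zeta> / (\<zeta> - z) * G \<zeta>) - G \<zeta>"
      by (simp only: left_diff_distrib mult.assoc mult_1_left)
  qed simp
  also have "\<dots> = 2 * pi * (2 * G z - G 0)"
    unfolding Bochner_Integration.integral_diff[OF i1 i3] integral_mult_right_zero
      Cauchy_arc_measure[OF cont hol z] mean_value_arc_measure[OF cont hol]
    by (simp add: algebra_simps)
  finally have A: "(\<integral>\<zeta>. (\<zeta> + z) / (\<zeta> - z) * G \<zeta> \<partial>arc_measure) = 2 * pi * (2 * G z - G 0)" .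
  have "(\<integral>\<zeta>. (\<zeta> + z) / (\<zeta> - z) * cnj (G \<zeta>) \<partial>arc_measure)
      = (\<integral>\<zeta>. cnj ((1 + cnj z * \<zeta>) / (1 - cnj z * \<zeta>) * G \<zeta>) \<partial>arc_measure)"
  proof (rule Bochner_Integration.integral_cong)
    fix \<zeta> assume "\<zeta> \<in> space arc_measure"
    then have \<zeta>: "norm \<zeta> = 1" by simp
    have "\<zeta> * (z * cnj \<zeta>) = z * (\<zeta> * cnj \<zeta>)" by (simp only: mult.left_commute)
    also have "\<zeta> * cnj \<zeta> = 1" using \<zeta> by (simp add: complex_norm_square[symmetric])
    finally have c: "\<zeta> * (1 + z * cnj \<zeta>) = \<zeta> + z" "\<zeta> * (1 - z * cnj \<zeta>) = \<zeta> - z" "\<zeta> \<noteq> 0"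
      using \<zeta> by (auto simp: distrib_left right_diff_distrib)
    have "(1 + z * cnj \<zeta>) / (1 - z * cnj \<zeta>) = (\<zeta> + z) / (\<zeta> - z)"
      unfolding c(1,2)[symmetric] using c(3) by (rule mult_divide_mult_cancel_left[symmetric])
    then show "(\<zeta> + z) / (\<zeta> - z) * cnj (G \<zeta>) = cnj ((1 + cnj z * \<zeta>) / (1 - cnj z * \<zeta>) * G \<zeta>)"
      by (simp only: complex_cnj_mult complex_cnj_divide complex_cnj_add complex_cnj_diff
          complex_cnj_one complex_cnj_cnj)
  qed simp
  also have "\<dots> = cnj (\<integral>\<zeta>. (1 + cnj z * \<zeta>) / (1 - cnj z * \<zeta>) * G \<zeta> \<partial>arc_measure)"
    by (rule Bochner_Integration.integral_cnj)
  also have "(\<integral>\<zeta>. (1 + cnj z * \<zeta>) / (1 - cnj z * \<zeta>) * G \<zeta> \<partial>arc_measure)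
      = 2 * pi * ((1 + cnj z * 0) / (1 - cnj z * 0) * G 0)"
    by (rule mean_value_arc_measure)
       (intro continuous_intros cont holomorphic_intros hol; use ne' in auto)+
  finally have B: "(\<integral>\<zeta>. (\<zeta> + z) / (\<zeta> - z) * cnj (G \<zeta>) \<partial>arc_measure) = 2 * pi * cnj (G 0)"
    by simp
  have i0: "integrable arc_measure (\<lambda>\<zeta>. (\<zeta> + z) / (\<zeta> - z) * G \<zeta>)"
    by (intro integrable_arc_measure_continuous continuous_intros gc; use ne in auto)
  have "(\<integral>\<zeta>. (\<zeta> + z) / (\<zeta> - z) * of_real (Re (G \<zeta>)) \<partial>arc_measure)
    = (\<integral>\<zeta>. ((\<zeta> + z) / (\<zeta> - z) * G \<zeta> + (\<zeta> + z) / (\<zeta> - z) * cnj (G \<zeta>)) / 2 \<partial>arc_measure)"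
  proof (rule Bochner_Integration.integral_cong)
    fix \<zeta>
    have "(G \<zeta> + cnj (G \<zeta>)) / 2 = of_real (Re (G \<zeta>))" by (simp add: complex_add_cnj)
    then show "(\<zeta> + z) / (\<zeta> - z) * of_real (Re (G \<zeta>))
        = ((\<zeta> + z) / (\<zeta> - z) * G \<zeta> + (\<zeta> + z) / (\<zeta> - z) * cnj (G \<zeta>)) / 2"
      by (simp only: distrib_left[symmetric] times_divide_eq_right[symmetric])
  qed simp
  also have "\<dots> = (2 * pi * (2 * G z - G 0) + 2 * pi * cnj (G 0)) / 2"
    by (simp only: integral_divide_zero Bochner_Integration.integral_add[OF i0 i2] A B)
  also have "\<dots> = 2 * pi * (G z - (G 0 - cnj (G 0)) / 2)"
    by (simp add: field_simps)
  also have "(G 0 - cnj (G 0)) / 2 = \<i> * Im (G 0)"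
    by (simp add: complex_diff_cnj)
  finally show ?thesis .
qed

section \<open>Weak compactness of uniformly integrable densities\<close>

text \<open>Convergence of the measures with densities \<open>d n\<close> against bounded continuous test functions. Complex test
functions spare a separation into real and imaginary parts when the Herglotz kernel is inserted.\<close>

definition weak_limit :: "real measure \<Rightarrow> (nat \<Rightarrow> real \<Rightarrow> real) \<Rightarrow> (real \<Rightarrow> real) \<Rightarrow> bool" where
  "weak_limit \<nu> d h \<longleftrightarrow>
    (\<forall>k :: real \<Rightarrow> complex. continuous_on UNIV k \<longrightarrow> bounded (range k) \<longrightarrow>
       (\<lambda>n. \<integral>x. k x * of_real (d n x) \<partial>\<nu>) \<longlonglongrightarrow> (\<integral>x. k x * of_real (h x) \<partial>\<nu>))"

lemma weak_limitD:
  "weak_limit \<nu> d h \<Longrightarrow> continuous_on UNIV k \<Longrightarrow> bounded (range k) \<Longrightarrow>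
    (\<lambda>n. \<integral>x. k x * of_real (d n x) \<partial>\<nu>) \<longlonglongrightarrow> (\<integral>x. k x * of_real (h x) \<partial>\<nu>)"
  for k :: "real \<Rightarrow> complex"
  unfolding weak_limit_def by blast

lemma integrable_bounded_continuous_mult:
  fixes k :: "real \<Rightarrow> complex" and g :: "real \<Rightarrow> real"
  assumes \<nu>: "finite_borel_measure \<nu>" and k: "continuous_on UNIV k" "bounded (range k)"
    and g: "integrable \<nu> g"
  shows "integrable \<nu> (\<lambda>x. k x * of_real (g x))"
proof -
  interpret finite_borel_measure \<nu> by (rule \<nu>)
  obtain B where B: "\<And>x. norm (k x) \<le> B" using k(2) by (auto simp: bounded_iff)
  have km: "k \<in> borel_measurable \<nu>"
    unfolding measurable_cong_sets[OF M_is_borel refl] by (rule borel_measurable_continuous_onI[OF k(1)])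
  show ?thesis
  proof (rule Bochner_Integration.integrable_bound)
    show "integrable \<nu> (\<lambda>x. B * g x)" using g by simp
    show "AE x in \<nu>. norm (k x * of_real (g x)) \<le> norm (B * g x)"
      using B order_trans[OF norm_ge_zero B] by (auto simp: norm_mult abs_mult intro!: mult_right_mono)
  qed (use km g in measurable)
qed

context
  fixes \<nu> :: "real measure" and d :: "nat \<Rightarrow> real \<Rightarrow> real"
  assumes \<nu>: "finite_borel_measure \<nu>" 
    and int: "\<And>n. integrable \<nu> (d n)" and nonneg: "\<And>n x. d n x \<ge> 0"
    and ui: "\<And>e. e > 0 \<Longrightarrow> \<exists>t. \<forall>n. (\<integral>x. max 0 (d n x - t) \<partial>\<nu>) \<le> e"
begin

interpretation finite_borel_measure \<nu> by (rule \<nu>)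

lemma space_base: "space \<nu> = UNIV"
  using sets_eq_imp_space_eq[OF M_is_borel] by simp

lemma borel_measurable_density: "d n \<in> borel_measurable borel"
  using borel_measurable_integrable[OF int] measurable_cong_sets[OF M_is_borel refl] by metis

text \<open>The use of uniform integrability: it bounds the integral of a test function against any of the
densities by a multiple of its \<open>\<nu>\<close>-integral, up to a small error. Tightness is obtained from it by testing with the
complement of a long interval, and absolute continuity of the limit by testing with a bump around a null set.\<close>

lemma integral_test_function_le:
  assumes "e > 0"
  shows "\<exists>t\<ge>0. \<forall>n k. k \<in> borel_measurable borel \<longrightarrow> (\<forall>x. 0 \<le> k x \<and> k x \<le> 1) \<longrightarrow>
    (\<integral>x. k x * d n x \<partial>\<nu>) \<le> t * (\<integral>x. k x \<partial>\<nu>) + e"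
proof -
  note [measurable_cong] = M_is_borel and [measurable] = borel_measurable_density and [simp] = space_base
  from ui[OF assms] obtain t where t: "\<And>n. (\<integral>x. max 0 (d n x - t) \<partial>\<nu>) \<le> e" by auto
  show ?thesis
  proof (intro exI[of _ "max t 0"] conjI allI impI)
    fix n and k :: "real \<Rightarrow> real" assume k[measurable]: "k \<in> borel_measurable borel" and "\<forall>x. 0 \<le> k x \<and> k x \<le> 1"
    then have b: "0 \<le> k x" "k x \<le> 1" for x by simp_all
    have ik: "integrable \<nu> k"
      by (rule integrable_const_bound[of _ 1]) (simp_all add: b)
    have im: "integrable \<nu> (\<lambda>x. max 0 (d n x - t))"
      by (intro integrable_max Bochner_Integration.integrable_diff int) simp_all
    have ikd: "integrable \<nu> (\<lambda>x. k x * d n x)"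
    proof (rule Bochner_Integration.integrable_bound[OF int[of n]])
      show "AE x in \<nu>. norm (k x * d n x) \<le> norm (d n x)"
        using b nonneg by (simp add: abs_mult mult_left_le_one_le)
    qed simp
    have "(\<integral>x. k x * d n x \<partial>\<nu>) \<le> (\<integral>x. max t 0 * k x + max 0 (d n x - t) \<partial>\<nu>)"
    proof (rule integral_mono)
      fix x
      have "k x * d n x \<le> k x * (max t 0 + max 0 (d n x - t))"
        by (rule mult_left_mono) (simp_all add: b)
      also have "\<dots> \<le> max t 0 * k x + max 0 (d n x - t)"
        using mult_left_le_one_le[OF _ b, of "max 0 (d n x - t)" x] by (simp add: distrib_left mult.commute)
      finally show "k x * d n x \<le> max t 0 * k x + max 0 (d n x - t)" .
    qed (simp_all add: ikd ik im)
    also have "\<dots> = max t 0 * (\<integral>x. k x \<partial>\<nu>) + (\<integral>x. max 0 (d n x - t) \<partial>\<nu>)"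
      using ik im by simp
    also have "\<dots> \<le> max t 0 * (\<integral>x. k x \<partial>\<nu>) + e" using t by simp
    finally show "(\<integral>x. k x * d n x \<partial>\<nu>) \<le> max t 0 * (\<integral>x. k x \<partial>\<nu>) + e" .
  qed auto
qed

text \<open>Helly selection yields a weak limit measure \<open>M\<close> of the probability measures with densities \<open>d n\<close>.
By inner regularity it vanishes on \<open>\<nu>\<close>-null sets as soon as it vanishes on compact ones, so
the Radon-Nikodym theorem supplies the limit density.\<close>

lemma weakly_compact_of_equi_integrable_prob:
  assumes one: "\<And>n. (\<integral>x. d n x \<partial>\<nu>) = 1"
  shows "\<exists>q h. strict_mono (q :: nat \<Rightarrow> nat) \<and> integrable \<nu> (h :: real \<Rightarrow> real) \<and>
    weak_limit \<nu> (\<lambda>n. d (q n)) h"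
proof -
  note [measurable_cong] = M_is_borel and [measurable] = borel_measurable_density and [simp] = space_base
  define \<mu> where "\<mu> n = density \<nu> (\<lambda>x. ennreal (d n x))" for n
  have emu: "emeasure (\<mu> n) A = ennreal (\<integral>x. indicator A x * d n x \<partial>\<nu>)" if "A \<in> sets borel" for n A
  proof -
    have "emeasure (\<mu> n) A = (\<integral>\<^sup>+x. ennreal (d n x) * indicator A x \<partial>\<nu>)"
      unfolding \<mu>_def by (rule emeasure_density) (simp_all add: that M_is_borel)
    also have "\<dots> = (\<integral>\<^sup>+x. ennreal (indicator A x * d n x) \<partial>\<nu>)"
      by (rule nn_integral_cong) (simp split: split_indicator)
    also have "\<dots> = ennreal (\<integral>x. indicator A x * d n x \<partial>\<nu>)"
      using integrable_mult_indicator[OF _ int[of n], of A] that nonneg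
      by (intro nn_integral_eq_integral) (simp_all add: M_is_borel)
    finally show ?thesis .
  qed
  have rd: "real_distribution (\<mu> n)" for n
  proof -
    have "emeasure (\<mu> n) (space (\<mu> n)) = 1"
      using emu[of UNIV n] one[of n] by (simp add: \<mu>_def)
    moreover have "sets (\<mu> n) = sets borel"
      using M_is_borel by (simp add: \<mu>_def)
    ultimately show ?thesis
      by (simp add: real_distribution_def real_distribution_axioms_def prob_spaceI)
  qed
  have meas: "measure (\<mu> n) A = (\<integral>x. indicator A x * d n x \<partial>\<nu>)" if "A \<in> sets borel" for n A
    using emu[OF that, of n] nonneg by (simp add: measure_def)
  have "tight \<mu>"
    unfolding tight_def
  proof (intro conjI allI impI rd)
    fix e :: real assume e: "e > 0"
    from integral_test_function_le[of "e/2"] e obtain t where t0: "t \<ge> 0" and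
      t: "\<And>n k. k \<in> borel_measurable borel \<Longrightarrow> (\<forall>x. 0 \<le> k x \<and> k x \<le> 1) \<Longrightarrow>
        (\<integral>x. k x * d n x \<partial>\<nu>) \<le> t * (\<integral>x. k x \<partial>\<nu>) + e/2" by (metis half_gt_zero)
    have "(\<lambda>n. measure \<nu> (- {- real n<..real n})) \<longlonglongrightarrow> measure \<nu> (\<Inter>n. - {- real n<..real n})"
      by (rule finite_Lim_measure_decseq) (auto simp: decseq_def M_is_borel)
    moreover have "(\<Inter>n. - {- real n<..real n}) = {}"
    proof -
      have "\<exists>n. x \<in> {- real n<..real n}" for x
      proof -
        obtain n where "\<bar>x\<bar> < real n" using reals_Archimedean2 by blast
        then show ?thesis by (intro exI[of _ n]) auto
      qed
      then show ?thesis by (simp add: set_eq_iff)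
    qed
    ultimately have "(\<lambda>n. t * measure \<nu> (- {- real n<..real n})) \<longlonglongrightarrow> 0"
      by (auto intro!: tendsto_eq_intros)
    then have "\<forall>\<^sub>F n in sequentially. t * measure \<nu> (- {- real n<..real n}) < e/2"
      using e by (intro order_tendstoD) auto
    then have "\<forall>\<^sub>F n in sequentially. t * measure \<nu> (- {- real n<..real n}) < e/2 \<and> n > 0"
      by (intro eventually_conj eventually_gt_at_top)
    then obtain N where N: "t * measure \<nu> (- {- real N<..real N}) < e/2" "N > 0"
      by (auto dest: eventually_happens)
    have "measure (\<mu> n) {- real N<..real N} > 1 - e" for n
    proof -
      interpret \<mu>: real_distribution "\<mu> n" by (rule rd)
      have "measure (\<mu> n) (- {- real N<..real N}) \<le> t * (\<integral>x. indicator (- {- real N<..real N}) x \<partial>\<nu>) + e/2"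
        unfolding meas[OF borel_comp[OF greaterThanAtMost_borel]]
        by (rule t) (simp_all split: split_indicator)
      also have "\<dots> < e" using N by (simp add: M_is_borel)
      finally show ?thesis
        using \<mu>.prob_compl[of "{- real N<..real N}"] by (simp add: Compl_eq_Diff_UNIV)
    qed
    then show "\<exists>a b. a < b \<and> (\<forall>n. 1 - e < measure (\<mu> n) {a<..b})"
      using N(2) by (intro exI[of _ "- real N"] exI[of _ "real N"]) auto
  qed
  from tight_imp_convergent_subsubsequence[OF this strict_mono_id] obtain q M where
    q: "strict_mono q" and M: "real_distribution M" and wc: "weak_conv_m (\<mu> \<circ> q) M"
    by (auto simp: o_def id_def)
  interpret M: real_distribution M by (rule M)
  have conv: "(\<lambda>n. \<integral>x. k x \<partial>\<mu> (q n)) \<longlonglongrightarrow> (\<integral>x. k x \<partial>M)"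
    if k: "continuous_on UNIV k" "bounded (range k)" for k :: "real \<Rightarrow> 'b::{banach,second_countable_topology}"
  proof -
    obtain B where "\<And>x. norm (k x) \<le> B" using k(2) by (auto simp: bounded_iff)
    then show ?thesis
      using weak_conv_imp_integral_bdd_continuous_conv[of "\<mu> \<circ> q" M k B] rd M wc k(1)
      by (auto simp: continuous_on_eq_continuous_at)
  qed
  have imu: "(\<integral>x. k x \<partial>\<mu> n) = (\<integral>x. d n x *\<^sub>R k x \<partial>\<nu>)"
    if "k \<in> borel_measurable borel" for n and k :: "real \<Rightarrow> 'b::{banach,second_countable_topology}"
    unfolding \<mu>_def using that nonneg by (subst integral_density) (auto simp: measurable_cong_sets[OF M_is_borel refl])
  have ac: "absolutely_continuous \<nu> M"
    unfolding absolutely_continuous_def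
  proof
    fix A assume A: "A \<in> null_sets \<nu>"
    have "emeasure M K = 0" if K: "K \<subseteq> A" "compact K" for K
    proof (cases "K = {}")
      case False
      have [measurable]: "K \<in> sets borel" using K by (auto simp: compact_imp_closed)
      then have \<nu>K: "measure \<nu> K = 0"
        using null_sets_subset[OF A _ K(1)] by (simp add: M_is_borel measure_def null_setsD1)
      \<comment> \<open>Continuous bumps decreasing to the indicator of the closed set \<open>K\<close>.\<close>
      define b where "b j x = max 0 (1 - real j * infdist x K)" for j x
      have bc: "continuous_on UNIV (b j)" for j unfolding b_def by (intro continuous_intros)
      have b01: "0 \<le> b j x" "b j x \<le> 1" for j x by (auto simp: b_def infdist_nonneg)
      have [measurable]: "b j \<in> borel_measurable borel" for j
        by (rule borel_measurable_continuous_onI[OF bc])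
      have lim: "(\<lambda>j. \<integral>x. b j x \<partial>\<nu>) \<longlonglongrightarrow> (\<integral>x. indicator K x \<partial>\<nu>)"
      proof (rule integral_dominated_convergence[where w="\<lambda>_. 1"])
        show "AE x in \<nu>. (\<lambda>j. b j x) \<longlonglongrightarrow> indicator K x"
        proof (rule AE_I2)
          fix x
          show "(\<lambda>j. b j x) \<longlonglongrightarrow> indicator K x"
          proof (cases "x \<in> K")
            case True then show ?thesis by (simp add: b_def)
          next
            case xK: False
            have "infdist x K > 0"
              using xK False K infdist_pos_not_in_closed compact_imp_closed by blast
            then obtain J where J: "real J * infdist x K > 1" using reals_Archimedean3 by blast
            have "b j x = 0" if "j \<ge> J" for j
            proof -
              have "real j * infdist x K \<ge> real J * infdist x K"
                using that by (intro mult_right_mono) (auto simp: infdist_nonneg)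
              with J show ?thesis by (simp add: b_def)
            qed
            then show ?thesis using xK
              by (intro tendsto_eventually) (auto simp: eventually_sequentially)
          qed
        qed
      qed (use b01 in \<open>auto simp: measurable_cong_sets[OF M_is_borel refl]\<close>)
      then have lim0: "(\<lambda>j. \<integral>x. b j x \<partial>\<nu>) \<longlonglongrightarrow> 0" using \<nu>K by (simp add: M_is_borel)
      have "measure M K \<le> e" if "e > 0" for e
      proof -
        from integral_test_function_le[OF that] obtain t where t0: "t \<ge> 0" and
          t: "\<And>n k. k \<in> borel_measurable borel \<Longrightarrow> (\<forall>x. 0 \<le> k x \<and> k x \<le> 1) \<Longrightarrow>
            (\<integral>x. k x * d n x \<partial>\<nu>) \<le> t * (\<integral>x. k x \<partial>\<nu>) + e" by metis
        have "measure M K \<le> t * (\<integral>x. b j x \<partial>\<nu>) + e" for j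
        proof -
          have "measure M K = (\<integral>x. indicator K x \<partial>M)" by simp
          also have "\<dots> \<le> (\<integral>x. b j x \<partial>M)"
          proof (rule integral_mono)
            show "integrable M (b j)"
              by (rule M.integrable_const_bound[of _ 1]) (simp_all add: b01)
            show "indicator K x \<le> b j x" for x
            proof (cases "x \<in> K")
              case True then show ?thesis by (simp add: b_def)
            next
              case False then show ?thesis using b01(1)[of j x] by simp
            qed
            show "integrable M (indicator K :: real \<Rightarrow> real)"
              by (rule M.integrable_const_bound[of _ 1]) simp_all
          qed
          also have "\<dots> \<le> t * (\<integral>x. b j x \<partial>\<nu>) + e"
          proof (rule LIMSEQ_le_const2[OF conv[OF bc]])
            show "bounded (range (b j))" by (rule boundedI[of _ 1]) (use b01 in auto)
            have "(\<integral>x. b j x \<partial>\<mu> (q n)) \<le> t * (\<integral>x. b j x \<partial>\<nu>) + e" for n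
              using t[of "b j" "q n"] b01 imu[of "b j" "q n"] by (simp add: mult.commute)
            then show "\<exists>N. \<forall>n\<ge>N. (\<integral>x. b j x \<partial>\<mu> (q n)) \<le> t * (\<integral>x. b j x \<partial>\<nu>) + e"
              by blast
          qed
          finally show ?thesis .
        qed
        moreover have "(\<lambda>j. t * (\<integral>x. b j x \<partial>\<nu>) + e) \<longlonglongrightarrow> t * 0 + e"
          by (intro tendsto_intros lim0)
        ultimately show ?thesis by (auto intro: LIMSEQ_le_const)
      qed
      then have "measure M K \<le> 0" by (metis field_le_epsilon add_0)
      then show ?thesis using measure_nonneg[of M K] by (simp add: M.emeasure_eq_measure antisym)
    qed simp
    then have "(SUP K \<in> {K. K \<subseteq> A \<and> compact K}. emeasure M K) \<le> 0"
      by (intro SUP_least) simp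
    moreover have "emeasure M A = (SUP K \<in> {K. K \<subseteq> A \<and> compact K}. emeasure M K)"
      using A null_setsD2[OF A] by (intro inner_regular) (simp_all add: M_is_borel)
    ultimately have "emeasure M A = 0" by simp
    then show "A \<in> null_sets M" using null_setsD2[OF A] by (intro null_setsI) (simp_all add: M_is_borel)
  qed
  obtain h where h[measurable]: "h \<in> borel_measurable \<nu>" and h0: "\<And>x. 0 \<le> h x"
    and RN: "AE x in \<nu>. RN_deriv \<nu> M x = ennreal (h x)"
    by (rule real_RN_deriv[OF M.finite_measure_axioms ac]) (auto simp: M_is_borel)
  have "density \<nu> (\<lambda>x. ennreal (h x)) = density \<nu> (RN_deriv \<nu> M)"
    using RN by (intro density_cong) auto
  also have "\<dots> = M" using ac by (intro density_RN_deriv) (auto simp: M_is_borel)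
  finally have dens: "M = density \<nu> (\<lambda>x. ennreal (h x))" by simp
  have "integrable \<nu> h"
    using M.integrable_const[of "1::real"] h h0 unfolding dens by (subst (asm) integrable_density) auto
  moreover have "(\<lambda>n. \<integral>x. k x * of_real (d (q n) x) \<partial>\<nu>) \<longlonglongrightarrow> (\<integral>x. k x * of_real (h x) \<partial>\<nu>)"
    if k: "continuous_on UNIV k" "bounded (range k)" for k :: "real \<Rightarrow> complex"
  proof -
    have km: "k \<in> borel_measurable borel" by (rule borel_measurable_continuous_onI[OF k(1)])
    have "(\<integral>x. k x \<partial>M) = (\<integral>x. h x *\<^sub>R k x \<partial>\<nu>)"
      unfolding dens using km h h0 by (subst integral_density) (auto simp: measurable_cong_sets[OF M_is_borel refl])
    then show ?thesis
      using conv[OF k] imu[OF km] by (simp add: scaleR_conv_of_real mult.commute)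
  qed
  ultimately show ?thesis using q unfolding weak_limit_def by blast
qed

end

text \<open>Reduction to probability densities. The masses are bounded, hence convergent along a
subsequence. Adding the constant \<open>1\<close> before normalising keeps the denominators away from \<open>0\<close>, even if
the masses tend to \<open>0\<close>; the price is the summand \<open>- 1\<close> in the limit density.\<close>

lemma weakly_compact_of_equi_integrable_nonneg:
  fixes d :: "nat \<Rightarrow> real \<Rightarrow> real"
  assumes \<nu>: "finite_borel_measure \<nu>" and V: "measure \<nu> UNIV > 0"
    and int: "\<And>n. integrable \<nu> (d n)" and nonneg: "\<And>n x. d n x \<ge> 0"
    and ui: "\<And>e. e > 0 \<Longrightarrow> \<exists>t. \<forall>n. (\<integral>x. max 0 (d n x - t) \<partial>\<nu>) \<le> e"
  shows "\<exists>q h. strict_mono (q :: nat \<Rightarrow> nat) \<and> integrable \<nu> (h :: real \<Rightarrow> real) \<and>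
    weak_limit \<nu> (\<lambda>n. d (q n)) h"
proof -
  interpret finite_borel_measure \<nu> by (rule \<nu>)
  define V where "V = measure \<nu> UNIV"
  have Vpos: "V > 0" using V by (simp add: V_def)
  have sp: "space \<nu> = UNIV" using sets_eq_imp_space_eq[OF M_is_borel] by simp
  define m where "m n = (\<integral>x. d n x \<partial>\<nu>)" for n
  have m0: "m n \<ge> 0" for n unfolding m_def by (rule integral_nonneg_AE) (simp add: nonneg)
  have int_max: "integrable \<nu> (\<lambda>x. max 0 (d n x - t))" for n t
    by (intro integrable_max Bochner_Integration.integrable_diff int) simp_all
  obtain t where t: "\<And>n. (\<integral>x. max 0 (d n x - t) \<partial>\<nu>) \<le> 1"
    using ui[of 1] by auto
  have "m n \<le> t * V + 1" for n
  proof -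
    have "m n \<le> (\<integral>x. t + max 0 (d n x - t) \<partial>\<nu>)"
      unfolding m_def by (intro integral_mono int Bochner_Integration.integrable_add int_max) simp_all
    also have "\<dots> = t * V + (\<integral>x. max 0 (d n x - t) \<partial>\<nu>)"
      using int_max by (simp add: V_def sp mult.commute)
    also have "\<dots> \<le> t * V + 1" using t by simp
    finally show ?thesis .
  qed
  then have "bounded (range m)"
    using m0 by (intro boundedI[of _ "t * V + 1"]) auto
  then obtain l q0 where q0: "strict_mono q0" and l: "(m \<circ> q0) \<longlonglongrightarrow> l"
    using bounded_imp_convergent_subsequence by metis
  define p where "p n x = (d (q0 n) x + 1) / (m (q0 n) + V)" for n x
  have den: "m n + V > 0" for n using m0[of n] Vpos by linarith
  have pint: "integrable \<nu> (p n)" for n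
    unfolding p_def by (intro integrable_divide Bochner_Integration.integrable_add int) simp
  have "\<exists>q h. strict_mono (q :: nat \<Rightarrow> nat) \<and> integrable \<nu> (h :: real \<Rightarrow> real) \<and>
    weak_limit \<nu> (\<lambda>n. p (q n)) h"
  proof (rule weakly_compact_of_equi_integrable_prob[OF \<nu> pint])
    show "p n x \<ge> 0" for n x
      unfolding p_def using nonneg[of "q0 n" x] den[of "q0 n"] by simp
    show "(\<integral>x. p n x \<partial>\<nu>) = 1" for n
    proof -
      have "(\<integral>x. p n x \<partial>\<nu>) = (m (q0 n) + V) / (m (q0 n) + V)"
        unfolding p_def using int by (simp add: m_def V_def sp)
      then show ?thesis using den[of "q0 n"] by simp
    qed
    fix e :: real assume "e > 0"
    then obtain s where s: "\<And>n. (\<integral>x. max 0 (d n x - s) \<partial>\<nu>) \<le> e * V"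
      using ui[of "e * V"] Vpos by auto
    have "(\<integral>x. max 0 (p n x - (s + 1) / V) \<partial>\<nu>) \<le> e" for n
    proof -
      have "(\<integral>x. max 0 (p n x - (s + 1) / V) \<partial>\<nu>) \<le> (\<integral>x. max 0 (d (q0 n) x - s) / V \<partial>\<nu>)"
      proof (rule integral_mono)
        fix x
        have "p n x \<le> (d (q0 n) x + 1) / V"
          unfolding p_def using nonneg[of "q0 n" x] m0[of "q0 n"] Vpos by (intro divide_left_mono) simp_all
        also have "(d (q0 n) x + 1) / V - (s + 1) / V = (d (q0 n) x - s) / V"
          by (simp add: diff_divide_distrib add_divide_distrib)
        then have "(d (q0 n) x + 1) / V = (d (q0 n) x - s) / V + (s + 1) / V" by simp
        also have "(d (q0 n) x - s) / V \<le> max 0 (d (q0 n) x - s) / V"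
          using Vpos by (intro divide_right_mono) simp_all
        finally have "p n x - (s + 1) / V \<le> max 0 (d (q0 n) x - s) / V" by simp
        moreover have "0 \<le> max 0 (d (q0 n) x - s) / V" using Vpos by simp
        ultimately show "max 0 (p n x - (s + 1) / V) \<le> max 0 (d (q0 n) x - s) / V" by simp
      next
        show "integrable \<nu> (\<lambda>x. max 0 (p n x - (s + 1) / V))"
          by (intro integrable_max Bochner_Integration.integrable_diff pint) simp_all
        show "integrable \<nu> (\<lambda>x. max 0 (d (q0 n) x - s) / V)"
          by (intro integrable_divide int_max)
      qed
      also have "\<dots> = (\<integral>x. max 0 (d (q0 n) x - s) \<partial>\<nu>) / V" by simp
      also have "\<dots> \<le> e" using s[of "q0 n"] Vpos by (simp add: divide_le_eq)
      finally show ?thesis .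
    qed
    then show "\<exists>t. \<forall>n. (\<integral>x. max 0 (p n x - t) \<partial>\<nu>) \<le> e" by blast
  qed
  then obtain q h where q: "strict_mono q" and h: "integrable \<nu> h" and
    conv: "weak_limit \<nu> (\<lambda>n. p (q n)) h"
    by blast
  have "(\<lambda>n. \<integral>x. k x * of_real (d ((q0 \<circ> q) n) x) \<partial>\<nu>)
      \<longlonglongrightarrow> (\<integral>x. k x * of_real ((l + V) * h x - 1) \<partial>\<nu>)"
    if k: "continuous_on UNIV k" "bounded (range k)" for k :: "real \<Rightarrow> complex"
  proof -
    note ikg = integrable_bounded_continuous_mult[OF \<nu> k]
    have ik: "integrable \<nu> k" using ikg[of "\<lambda>_. 1"] by simp
    have eq: "(\<integral>x. k x * of_real (d ((q0 \<circ> q) n) x) \<partial>\<nu>)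
        = of_real (m (q0 (q n)) + V) * (\<integral>x. k x * of_real (p (q n) x) \<partial>\<nu>) - (\<integral>x. k x \<partial>\<nu>)" for n
    proof -
      have "(\<integral>x. k x * of_real (d ((q0 \<circ> q) n) x) \<partial>\<nu>)
          = (\<integral>x. of_real (m (q0 (q n)) + V) * (k x * of_real (p (q n) x)) - k x \<partial>\<nu>)"
      proof (rule Bochner_Integration.integral_cong)
        fix x
        have "d ((q0 \<circ> q) n) x = (m (q0 (q n)) + V) * p (q n) x - 1"
          using den[of "q0 (q n)"] by (simp add: p_def)
        then have "complex_of_real (d ((q0 \<circ> q) n) x) = of_real (m (q0 (q n)) + V) * of_real (p (q n) x) - 1"
          by simp
        then show "k x * of_real (d ((q0 \<circ> q) n) x) = of_real (m (q0 (q n)) + V) * (k x * of_real (p (q n) x)) - k x"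
          by (simp only: right_diff_distrib mult.left_commute mult_1_right)
      qed simp
      also have "\<dots> = of_real (m (q0 (q n)) + V) * (\<integral>x. k x * of_real (p (q n) x) \<partial>\<nu>) - (\<integral>x. k x \<partial>\<nu>)"
        using ikg[OF pint[of "q n"]] ik by simp
      finally show ?thesis .
    qed
    have "(\<lambda>n. m (q0 (q n))) \<longlonglongrightarrow> l"
      using LIMSEQ_subseq_LIMSEQ[OF l q] by (simp add: o_def)
    then have "(\<lambda>n. \<integral>x. k x * of_real (d ((q0 \<circ> q) n) x) \<partial>\<nu>)
        \<longlonglongrightarrow> of_real (l + V) * (\<integral>x. k x * of_real (h x) \<partial>\<nu>) - (\<integral>x. k x \<partial>\<nu>)"
      unfolding eq by (intro tendsto_intros weak_limitD[OF conv] k)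
    also have "of_real (l + V) * (\<integral>x. k x * of_real (h x) \<partial>\<nu>) - (\<integral>x. k x \<partial>\<nu>)
        = (\<integral>x. of_real (l + V) * (k x * of_real (h x)) - k x \<partial>\<nu>)"
      using ikg[OF h] ik by simp
    also have "\<dots> = (\<integral>x. k x * of_real ((l + V) * h x - 1) \<partial>\<nu>)"
      by (rule Bochner_Integration.integral_cong) (simp_all add: algebra_simps)
    finally show ?thesis .
  qed
  moreover have "integrable \<nu> (\<lambda>x. (l + V) * h x - 1)" using h by simp
  moreover have "strict_mono (q0 \<circ> q)" using q0 q by (rule strict_mono_o)
  ultimately show ?thesis unfolding weak_limit_def by blast
qed

text \<open>The positive and the negative parts are treated in turn, the second along the subsequence
selected for the first.\<close>

lemma weakly_compact_of_equi_integrable: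
  fixes d :: "nat \<Rightarrow> real \<Rightarrow> real"
  assumes \<nu>: "finite_borel_measure \<nu>" and V: "measure \<nu> UNIV > 0"
    and int: "\<And>n. integrable \<nu> (d n)"
    and ui: "\<And>e. e > 0 \<Longrightarrow> \<exists>t. \<forall>n. (\<integral>x. max 0 (\<bar>d n x\<bar> - t) \<partial>\<nu>) \<le> e"
  shows "\<exists>q h. strict_mono (q :: nat \<Rightarrow> nat) \<and> integrable \<nu> (h :: real \<Rightarrow> real) \<and>
    weak_limit \<nu> (\<lambda>n. d (q n)) h"
proof -
  interpret finite_borel_measure \<nu> by (rule \<nu>)
  have part: "\<exists>t. \<forall>n. (\<integral>x. max 0 (g n x - t) \<partial>\<nu>) \<le> e"
    if "e > 0" and g: "\<And>n. integrable \<nu> (g n)" "\<And>n x. g n x \<le> \<bar>d (r n) x\<bar>"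
    for e r and g :: "nat \<Rightarrow> real \<Rightarrow> real"
  proof -
    obtain t where t: "\<And>n. (\<integral>x. max 0 (\<bar>d n x\<bar> - t) \<partial>\<nu>) \<le> e" using ui[OF \<open>e > 0\<close>] by auto
    have "(\<integral>x. max 0 (g n x - t) \<partial>\<nu>) \<le> (\<integral>x. max 0 (\<bar>d (r n) x\<bar> - t) \<partial>\<nu>)" for n
    proof (rule integral_mono)
      show "max 0 (g n x - t) \<le> max 0 (\<bar>d (r n) x\<bar> - t)" for x
        using g(2)[of n x] by linarith
    qed (intro integrable_max Bochner_Integration.integrable_diff integrable_abs g int; simp)+
    then show ?thesis using t by (meson order_trans)
  qed
  define dp where "dp n x = max 0 (d n x)" for n x
  define dn where "dn n x = max 0 (- d n x)" for n x
  have idp: "integrable \<nu> (dp n)" and idn: "integrable \<nu> (dn n)" for n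
    unfolding dp_def dn_def by (intro integrable_max int Bochner_Integration.integrable_minus; simp)+
  have "\<exists>q h. strict_mono (q :: nat \<Rightarrow> nat) \<and> integrable \<nu> (h :: real \<Rightarrow> real) \<and>
    weak_limit \<nu> (\<lambda>n. dp (q n)) h"
    by (rule weakly_compact_of_equi_integrable_nonneg[OF \<nu> V idp])
       (auto simp: dp_def intro!: part[where r=id] idp[unfolded dp_def])
  then obtain q1 h1 where q1: "strict_mono q1" and h1: "integrable \<nu> h1" and
    conv1: "weak_limit \<nu> (\<lambda>n. dp (q1 n)) h1"
    by blast
  have "\<exists>q h. strict_mono (q :: nat \<Rightarrow> nat) \<and> integrable \<nu> (h :: real \<Rightarrow> real) \<and>
    weak_limit \<nu> (\<lambda>n. dn (q1 (q n))) h"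
    by (rule weakly_compact_of_equi_integrable_nonneg[OF \<nu> V, where d="\<lambda>n. dn (q1 n)"])
       (auto simp: dn_def intro!: part[where r=q1] idn idn[unfolded dn_def])
  then obtain q2 h2 where q2: "strict_mono q2" and h2: "integrable \<nu> h2" and
    conv2: "weak_limit \<nu> (\<lambda>n. dn (q1 (q2 n))) h2"
    by blast
  have "(\<lambda>n. \<integral>x. k x * of_real (d ((q1 \<circ> q2) n) x) \<partial>\<nu>) \<longlonglongrightarrow> (\<integral>x. k x * of_real (h1 x - h2 x) \<partial>\<nu>)"
    if k: "continuous_on UNIV k" "bounded (range k)" for k :: "real \<Rightarrow> complex"
  proof -
    note ikg = integrable_bounded_continuous_mult[OF \<nu> k]
    have split: "(\<integral>x. k x * of_real (u x - v x) \<partial>\<nu>) = (\<integral>x. k x * of_real (u x) \<partial>\<nu>) - (\<integral>x. k x * of_real (v x) \<partial>\<nu>)"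
      if "integrable \<nu> u" "integrable \<nu> v" for u v :: "real \<Rightarrow> real"
      using ikg[OF that(1)] ikg[OF that(2)] by (simp add: right_diff_distrib)
    have "d n x = dp n x - dn n x" for n x by (auto simp: dp_def dn_def)
    then show ?thesis
      using tendsto_diff[OF LIMSEQ_subseq_LIMSEQ[OF weak_limitD[OF conv1 k] q2] weak_limitD[OF conv2 k]]
      by (simp only: split[OF h1 h2] split[OF idp idn] o_def)
  qed
  moreover have "integrable \<nu> (\<lambda>x. h1 x - h2 x)" using h1 h2 by simp
  moreover have "strict_mono (q1 \<circ> q2)" using q1 q2 by (rule strict_mono_o)
  ultimately show ?thesis unfolding weak_limit_def by blast
qed

section \<open>Uniform integrability implies outer\<close>

text \<open>\<open>Arg2pi\<close> is continuous off the nonnegative real axis, and constant on it. It carries functions of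
the angle back to the circle.\<close>

lemma borel_measurable_Arg2pi: "Arg2pi \<in> borel_measurable borel"
proof -
  have "(\<lambda>z. if z \<in> \<real>\<^sub>\<ge>\<^sub>0 then 0 else Arg2pi z) \<in> borel_measurable borel"
    by (intro borel_measurable_continuous_on_if borel_closed closed_nonneg_Reals_complex continuous_on_const)
       (auto intro!: continuous_at_imp_continuous_on continuous_at_Arg2pi)
  also have "(\<lambda>z. if z \<in> \<real>\<^sub>\<ge>\<^sub>0 then 0 else Arg2pi z) = Arg2pi"
    by (auto simp: fun_eq_iff Arg2pi_eq_0 complex_nonneg_Reals_iff complex_is_Real_iff)
  finally show ?thesis .
qed

lemma Arg2pi_cis: "0 \<le> x \<Longrightarrow> x < 2 * pi \<Longrightarrow> Arg2pi (cis x) = x"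
  by (rule Arg2pi_unique[of 1]) (simp_all add: cis_conv_exp)

lemma radial_limit_eq:
  assumes "isCont g \<zeta>"
  shows "radial_limit g \<zeta> = g \<zeta>"
proof -
  have "((\<lambda>t. of_real t * \<zeta>) \<longlongrightarrow> of_real 1 * \<zeta>) (at_left 1)"
    by (intro tendsto_intros)
  then have "((\<lambda>t. g (of_real t * \<zeta>)) \<longlongrightarrow> g \<zeta>) (at_left 1)"
    using isCont_tendsto_compose[OF assms] by simp
  then show ?thesis unfolding radial_limit_def by (intro tendsto_Lim) simp_all
qed

lemma Herglotz_kernel_bound:
  fixes z \<zeta> :: complex
  assumes "norm z < 1" "norm \<zeta> = 1"
  shows "norm ((\<zeta> + z) / (\<zeta> - z)) \<le> 2 / (1 - norm z)"
proof -
  have "norm (\<zeta> + z) \<le> 2" using norm_triangle_ineq[of \<zeta> z] assms by simp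
  moreover have "norm (\<zeta> - z) \<ge> 1 - norm z" using norm_triangle_ineq2[of \<zeta> z] assms by simp
  ultimately show ?thesis using assms by (simp add: norm_divide frac_le)
qed

lemma equi_integrable_if_uniformly_integrable:
  assumes ui: "uniformly_integrable arc_measure \<G>" and "e > 0"
  shows "\<exists>t. \<forall>g\<in>\<G>. (\<integral>\<^sup>+\<zeta>. ennreal (max 0 (\<bar>g \<zeta>\<bar> - t)) \<partial>arc_measure) \<le> ennreal e"
proof -
  have "\<forall>\<^sub>F t in at_top. (SUP g\<in>\<G>. \<integral>\<^sup>+x\<in>{x \<in> space arc_measure. norm (g x) \<ge> t}. ennreal (norm (g x)) \<partial>arc_measure) < ennreal e"
    using ui \<open>e > 0\<close> unfolding uniformly_integrable_def by (intro order_tendstoD) auto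
  then have "\<forall>\<^sub>F t in at_top. t \<ge> 0 \<and> (SUP g\<in>\<G>. \<integral>\<^sup>+x\<in>{x \<in> space arc_measure. norm (g x) \<ge> t}. ennreal (norm (g x)) \<partial>arc_measure) < ennreal e"
    using eventually_ge_at_top[of "0::real"] by eventually_elim simp
  then obtain t where t0: "t \<ge> 0" and t: "(SUP g\<in>\<G>. \<integral>\<^sup>+x\<in>{x \<in> space arc_measure. norm (g x) \<ge> t}. ennreal (norm (g x)) \<partial>arc_measure) < ennreal e"
    by (auto dest: eventually_happens)
  have "(\<integral>\<^sup>+\<zeta>. ennreal (max 0 (\<bar>g \<zeta>\<bar> - t)) \<partial>arc_measure) \<le> ennreal e" if "g \<in> \<G>" for g
  proof -
    have "(\<integral>\<^sup>+\<zeta>. ennreal (max 0 (\<bar>g \<zeta>\<bar> - t)) \<partial>arc_measure)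
        \<le> (\<integral>\<^sup>+x\<in>{x \<in> space arc_measure. norm (g x) \<ge> t}. ennreal (norm (g x)) \<partial>arc_measure)"
      by (rule nn_integral_mono) (use t0 in \<open>auto simp: indicator_def ennreal_neg intro!: ennreal_leI\<close>)
    also have "\<dots> \<le> (SUP g\<in>\<G>. \<integral>\<^sup>+x\<in>{x \<in> space arc_measure. norm (g x) \<ge> t}. ennreal (norm (g x)) \<partial>arc_measure)"
      using that by (rule SUP_upper)
    finally show ?thesis using t by simp
  qed
  then show ?thesis by blast
qed

lemma scaling_in_schur_class_le:
  assumes "0 \<le> r" "r < 1" "0 \<le> a"
  shows "(\<lambda>z. of_real r * z) \<in> schur_class_le a"
proof -
  have "norm (of_real r * z) < 1" if "norm z < 1" for z :: complex
    using assms that mult_left_le[of "norm z" r] by (simp add: norm_mult)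
  then show ?thesis
    using assms by (auto simp: schur_class_le_def schur_class_def intro!: holomorphic_intros)
qed

text \<open>The functions \<open>d n\<close> are the boundary values of \<open>log |f|\<close> dilated by radii \<open>r n\<close> tending to \<open>1\<close>. A weak limit \<open>h\<close>
of a subsequence inherits the Schwarz formula, for each \<open>z\<close> in the disk separately.\<close>

lemma outer_if_uniformly_integrable:
  assumes hol: "f holomorphic_on unit_disk" and nz: "\<forall>z\<in>unit_disk. f z \<noteq> 0" and "0 \<le> a"
    and ui: "uniformly_integrable arc_measure
      ((\<lambda>\<psi> \<zeta>. ln (norm (radial_limit (f \<circ> \<psi>) \<zeta>))) ` schur_class_le a)"
  shows "outer f"
proof -
  \<comment> \<open>The disk is simply connected, so \<open>f\<close> has a holomorphic logarithm.\<close>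
  obtain G where G: "G holomorphic_on unit_disk" and expG: "\<And>z. z \<in> unit_disk \<Longrightarrow> exp (G z) = f z"
    by (rule holomorphic_logarithm_exists[OF convex_ball open_ball hol, of 0]) (use nz in auto)
  note fG = expG[symmetric]
  define r where "r n = real n / (real n + 1)" for n
  have r: "0 \<le> r n" "r n < 1" for n by (simp_all add: r_def)
  have rlim: "r \<longlonglongrightarrow> 1" unfolding r_def by real_asymp
  have Gcont: "continuous_on unit_disk G" using G by (rule holomorphic_on_imp_continuous_on)
  have in_disk: "norm (of_real (r n) * z) < 1" if "norm z \<le> 1" for n and z :: complex
    using r[of n] that mult_left_le[of "norm z" "r n"] by (simp add: norm_mult)
  define G' where "G' n z = G (of_real (r n) * z)" for n z
  have G'cont: "continuous_on (cball 0 1) (G' n)" for n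
    unfolding G'_def by (intro continuous_on_compose2[OF Gcont] continuous_intros) (use in_disk in auto)
  have G'hol: "G' n holomorphic_on ball 0 1" for n
    unfolding G'_def
    by (intro holomorphic_on_compose_gen[OF _ G, unfolded o_def] holomorphic_intros) (use in_disk in auto)
  have radial: "ln (norm (radial_limit (f \<circ> (\<lambda>z. of_real (r n) * z)) \<zeta>)) = Re (G' n \<zeta>)"
    if \<zeta>: "norm \<zeta> = 1" for n \<zeta>
  proof -
    have "isCont f (of_real (r n) * \<zeta>)"
      using holomorphic_on_imp_continuous_on[OF hol] in_disk[of \<zeta> n] \<zeta>
      by (simp add: continuous_on_eq_continuous_at)
    then have "isCont (f \<circ> (\<lambda>z. of_real (r n) * z)) \<zeta>"
      by (intro continuous_at_compose continuous_intros) simp_all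
    then show ?thesis
      using in_disk[of \<zeta> n] \<zeta> by (simp add: radial_limit_eq fG G'_def)
  qed
  define d where "d n x = Re (G' n (cis x))" for n x
  have G'sphere: "continuous_on unit_circle (G' n)" for n
    by (rule continuous_on_subset[OF G'cont]) auto
  have dcont: "continuous_on UNIV (d n)" for n
    unfolding d_def by (intro continuous_intros continuous_on_compose2[OF G'sphere]) auto
  have dint: "integrable angle_measure (d n)" for n
    unfolding d_def
    by (subst integrable_arc_measure_iff[symmetric])
       (intro integrable_arc_measure_continuous borel_measurable_continuous_on_restrict continuous_intros G'sphere)+
  interpret finite_borel_measure angle_measure by (rule finite_angle_measure)
  have "\<exists>q h. strict_mono (q :: nat \<Rightarrow> nat) \<and> integrable angle_measure (h :: real \<Rightarrow> real) \<and>
    weak_limit angle_measure (\<lambda>n. d (q n)) h"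
  proof (rule weakly_compact_of_equi_integrable[OF finite_angle_measure _ dint])
    show "0 < measure angle_measure UNIV"
      by (simp add: measure_def emeasure_angle_measure_UNIV)
    fix e :: real assume "e > 0"
    from equi_integrable_if_uniformly_integrable[OF ui this] obtain t where
      t: "\<And>\<psi>. \<psi> \<in> schur_class_le a \<Longrightarrow>
        (\<integral>\<^sup>+\<zeta>. ennreal (max 0 (\<bar>ln (norm (radial_limit (f \<circ> \<psi>) \<zeta>))\<bar> - t)) \<partial>arc_measure) \<le> ennreal e"
      by auto
    have "(\<integral>x. max 0 (\<bar>d n x\<bar> - t) \<partial>angle_measure) \<le> e" for n
    proof -
      have "ennreal (\<integral>x. max 0 (\<bar>d n x\<bar> - t) \<partial>angle_measure)
          = (\<integral>\<^sup>+x. ennreal (max 0 (\<bar>d n x\<bar> - t)) \<partial>angle_measure)"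
        by (intro nn_integral_eq_integral[symmetric] integrable_max Bochner_Integration.integrable_diff
            integrable_abs dint) simp_all
      also have "\<dots> = (\<integral>\<^sup>+\<zeta>. ennreal (max 0 (\<bar>Re (G' n \<zeta>)\<bar> - t)) \<partial>arc_measure)"
      proof -
        have [measurable]: "(\<lambda>\<zeta>. Re (G' n \<zeta>)) \<in> borel_measurable (restrict_space borel unit_circle)"
          by (intro borel_measurable_continuous_on_restrict continuous_intros G'sphere)
        show ?thesis unfolding d_def by (rule nn_integral_arc_measure[symmetric]) measurable
      qed
      also have "\<dots> = (\<integral>\<^sup>+\<zeta>. ennreal (max 0 (\<bar>ln (norm (radial_limit (f \<circ> (\<lambda>z. of_real (r n) * z)) \<zeta>))\<bar> - t)) \<partial>arc_measure)"
        by (rule nn_integral_cong) (simp add: radial)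
      also have "\<dots> \<le> ennreal e"
        by (intro t scaling_in_schur_class_le r \<open>0 \<le> a\<close>)
      finally show ?thesis using \<open>e > 0\<close> by simp
    qed
    then show "\<exists>t. \<forall>n. (\<integral>x. max 0 (\<bar>d n x\<bar> - t) \<partial>angle_measure) \<le> e" by blast
  qed
  then obtain q h where q: "strict_mono q" and h: "integrable angle_measure h" and
    conv: "weak_limit angle_measure (\<lambda>n. d (q n)) h"
    by blast
  define H where "H \<zeta> = h (Arg2pi \<zeta>)" for \<zeta>
  have hm: "h \<in> borel_measurable borel"
    using borel_measurable_integrable[OF h] measurable_cong_sets[OF sets_angle_measure refl] by metis
  have Hm: "H \<in> borel_measurable (restrict_space borel unit_circle)"
    unfolding H_def by (intro measurable_restrict_space1 measurable_compose[OF borel_measurable_Arg2pi hm])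
  have Hcis: "AE x in angle_measure. H (cis x) = h x"
    using AE_angle_measure by eventually_elim (simp add: H_def Arg2pi_cis)
  have rep: "(\<integral>\<zeta>. (\<zeta> + z) / (\<zeta> - z) * of_real (H \<zeta>) \<partial>arc_measure) = 2 * pi * (G z - \<i> * Im (G 0))"
    if z: "z \<in> unit_disk" for z
  proof -
    have z1: "norm z < 1" using z by simp
    define k where "k x = (cis x + z) / (cis x - z)" for x
    have "cis x \<noteq> z" for x using z1 by (metis norm_cis less_irrefl)
    then have kc: "continuous_on UNIV k" unfolding k_def by (intro continuous_intros) simp
    have kb: "bounded (range k)"
      using Herglotz_kernel_bound[OF z1, of "cis x" for x] unfolding k_def by (intro boundedI) auto
    have kernel: "continuous_on unit_circle (\<lambda>\<zeta>. (\<zeta> + z) / (\<zeta> - z))"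
      by (intro continuous_intros) (use z1 in auto)
    have eq: "(\<integral>x. k x * of_real (d (q n) x) \<partial>angle_measure) = 2 * pi * (G' (q n) z - \<i> * Im (G 0))" for n
    proof -
      have "(\<integral>x. k x * of_real (d (q n) x) \<partial>angle_measure)
          = (\<integral>\<zeta>. (\<zeta> + z) / (\<zeta> - z) * of_real (Re (G' (q n) \<zeta>)) \<partial>arc_measure)"
        unfolding k_def d_def
        by (rule integral_arc_measure[symmetric])
           (intro borel_measurable_continuous_on_restrict continuous_intros kernel G'sphere)
      also have "\<dots> = 2 * pi * (G' (q n) z - \<i> * Im (G' (q n) 0))"
        by (rule Schwarz_integral_formula[OF G'cont G'hol z1])
      finally show ?thesis by (simp add: G'_def)
    qed
    have "(\<lambda>n. 2 * pi * (G' (q n) z - \<i> * Im (G 0))) \<longlonglongrightarrow> 2 * pi * (G z - \<i> * Im (G 0))"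
    proof -
      have "(\<lambda>n. r (q n)) \<longlonglongrightarrow> 1" using LIMSEQ_subseq_LIMSEQ[OF rlim q] by (simp add: o_def)
      then have "(\<lambda>n. of_real (r (q n)) * z) \<longlonglongrightarrow> of_real 1 * z" by (intro tendsto_intros)
      moreover have "isCont G z" using Gcont z by (simp add: continuous_on_eq_continuous_at)
      ultimately have "(\<lambda>n. G' (q n) z) \<longlonglongrightarrow> G z"
        unfolding G'_def by (intro isCont_tendsto_compose[of _ G]) simp_all
      then show ?thesis by (intro tendsto_intros)
    qed
    then have "(\<integral>x. k x * of_real (h x) \<partial>angle_measure) = 2 * pi * (G z - \<i> * Im (G 0))"
      by (rule LIMSEQ_unique[OF weak_limitD[OF conv kc kb, unfolded eq]])
    moreover have "(\<integral>\<zeta>. (\<zeta> + z) / (\<zeta> - z) * of_real (H \<zeta>) \<partial>arc_measure)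
        = (\<integral>x. k x * of_real (H (cis x)) \<partial>angle_measure)"
      unfolding k_def
      by (rule integral_arc_measure)
         (use Hm borel_measurable_continuous_on_restrict[OF kernel] in measurable)
    moreover have "\<dots> = (\<integral>x. k x * of_real (h x) \<partial>angle_measure)"
    proof (rule integral_cong_AE)
      have "(\<lambda>x. H (cis x)) \<in> borel_measurable angle_measure"
        by (rule measurable_compose[OF cis_measurable_circle Hm])
      moreover have "k \<in> borel_measurable angle_measure"
        unfolding measurable_cong_sets[OF sets_angle_measure refl] by (rule borel_measurable_continuous_onI[OF kc])
      moreover have "h \<in> borel_measurable angle_measure" by (rule borel_measurable_integrable[OF h])
      ultimately show "(\<lambda>x. k x * of_real (H (cis x))) \<in> borel_measurable angle_measure"
        and "(\<lambda>x. k x * of_real (h x)) \<in> borel_measurable angle_measure" by measurable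
    qed (use Hcis in eventually_elim, simp)
    ultimately show ?thesis by simp
  qed
  have Hint: "integrable arc_measure H"
    unfolding integrable_arc_measure_iff[OF Hm]
    using h Hcis measurable_compose[OF cis_measurable_circle Hm]
    by (subst integrable_cong_AE[where g=h]) (auto intro: borel_measurable_integrable)
  show ?thesis
    unfolding outer_def
  proof (intro conjI hol exI[of _ "exp (\<i> * Im (G 0))"] exI[of _ "\<lambda>\<zeta>. exp (H \<zeta>)"] ballI)
    fix z assume z: "z \<in> unit_disk"
    have "(\<integral>\<zeta>. (\<zeta> + z) / (\<zeta> - z) * of_real (ln (exp (H \<zeta>))) \<partial>arc_measure) / of_real (2 * pi)
        = G z - \<i> * Im (G 0)"
      using rep[OF z] by simp
    then show "f z = exp (\<i> * Im (G 0)) * exp ((LINT \<zeta>|arc_measure. (\<zeta> + z) / (\<zeta> - z) * of_real (ln (exp (H \<zeta>))))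
        / of_real (2 * pi))"
      by (simp only: fG[OF z] exp_add[symmetric]) simp
  qed (use Hint in simp_all)
qed

section \<open>Measurability of radial limits\<close>

text \<open>The Cauchy criterion with countably many tolerances and countably many neighbourhoods of \<open>1\<close>. The
remaining quantifiers over \<open>s\<close> and \<open>t\<close> are uncountable, but on the circle they will intersect closed
sets, which keeps the set of convergence Borel.\<close>

lemma left_limit_iff_Cauchy:
  fixes \<gamma> :: "real \<Rightarrow> 'a::complete_space"
  shows "(\<exists>l. (\<gamma> \<longlongrightarrow> l) (at_left 1)) \<longleftrightarrow>
    (\<forall>k::nat. \<exists>N::nat. \<forall>s\<in>{1 - 1 / (real N + 1)<..<1}. \<forall>t\<in>{1 - 1 / (real N + 1)<..<1}.
       dist (\<gamma> s) (\<gamma> t) \<le> 1 / (real k + 1))"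
proof (intro iffI allI)
  fix k :: nat
  assume "\<exists>l. (\<gamma> \<longlongrightarrow> l) (at_left 1)"
  then obtain l where "(\<gamma> \<longlongrightarrow> l) (at_left 1)" by blast
  then have "\<forall>\<^sub>F s in at_left 1. dist (\<gamma> s) l < 1 / (real k + 1) / 2"
    by (rule tendstoD) simp
  then obtain b where b: "b < 1" "\<And>s. b < s \<Longrightarrow> s < 1 \<Longrightarrow> dist (\<gamma> s) l < 1 / (real k + 1) / 2"
    by (auto simp: eventually_at_left[of 0])
  obtain N where N: "inverse (real (Suc N)) < 1 - b"
    using reals_Archimedean[of "1 - b"] b(1) by auto
  have "dist (\<gamma> s) (\<gamma> t) \<le> 1 / (real k + 1)"
    if "s \<in> {1 - 1 / (real N + 1)<..<1}" "t \<in> {1 - 1 / (real N + 1)<..<1}" for s t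
  proof -
    have "b < 1 - 1 / (real N + 1)" using N by (simp add: inverse_eq_divide add.commute)
    then have "dist (\<gamma> s) l < 1 / (real k + 1) / 2" "dist (\<gamma> t) l < 1 / (real k + 1) / 2"
      using that b(2)[of s] b(2)[of t] by simp_all
    then show ?thesis using dist_triangle2[of "\<gamma> s" "\<gamma> t" l] by linarith
  qed
  then show "\<exists>N::nat. \<forall>s\<in>{1 - 1 / (real N + 1)<..<1}. \<forall>t\<in>{1 - 1 / (real N + 1)<..<1}.
       dist (\<gamma> s) (\<gamma> t) \<le> 1 / (real k + 1)" by blast
next
  assume C: "\<forall>k::nat. \<exists>N::nat. \<forall>s\<in>{1 - 1 / (real N + 1)<..<1}. \<forall>t\<in>{1 - 1 / (real N + 1)<..<1}.
       dist (\<gamma> s) (\<gamma> t) \<le> 1 / (real k + 1)"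
  have small: "\<exists>N::nat. \<forall>s\<in>{1 - 1 / (real N + 1)<..<1}. \<forall>t\<in>{1 - 1 / (real N + 1)<..<1}.
       dist (\<gamma> s) (\<gamma> t) < e" if "e > 0" for e
  proof -
    obtain k where "inverse (real (Suc k)) < e" using reals_Archimedean[OF \<open>e > 0\<close>] by blast
    then have "1 / (real k + 1) < e" by (simp add: inverse_eq_divide add.commute)
    with C show ?thesis by (meson order_le_less_trans)
  qed
  define x where "x n = \<gamma> (1 - 1 / (real n + 2))" for n
  have in_int: "1 - 1 / (real n + 2) \<in> {1 - 1 / (real N + 1)<..<1}" if "n \<ge> N" for n N
    using that by (simp add: frac_less2)
  have "Cauchy x"
    unfolding Cauchy_def x_def using small in_int by meson
  then obtain l where l: "x \<longlonglongrightarrow> l" using convergent_eq_Cauchy by blast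
  have "(\<gamma> \<longlongrightarrow> l) (at_left 1)"
  proof (rule tendstoI)
    fix e :: real assume "e > 0"
    then obtain N where N: "\<And>s t. s \<in> {1 - 1 / (real N + 1)<..<1} \<Longrightarrow> t \<in> {1 - 1 / (real N + 1)<..<1} \<Longrightarrow>
       dist (\<gamma> s) (\<gamma> t) < e / 2" using small[of "e / 2"] by (metis half_gt_zero)
    have "dist (\<gamma> s) l \<le> e / 2" if "s \<in> {1 - 1 / (real N + 1)<..<1}" for s
    proof (rule LIMSEQ_le_const2)
      show "(\<lambda>n. dist (\<gamma> s) (x n)) \<longlonglongrightarrow> dist (\<gamma> s) l" by (intro tendsto_intros l)
      show "\<exists>M. \<forall>n\<ge>M. dist (\<gamma> s) (x n) \<le> e / 2"
        unfolding x_def using N[OF that in_int] by (intro exI[of _ N]) (auto intro: less_imp_le)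
    qed
    moreover have "\<forall>\<^sub>F s in at_left 1. s \<in> {1 - 1 / (real N + 1)<..<1}"
      by (rule eventually_at_left_real) simp
    ultimately show "\<forall>\<^sub>F s in at_left 1. dist (\<gamma> s) l < e"
      using \<open>e > 0\<close> by (elim eventually_mono) fastforce
  qed
  then show "\<exists>l. (\<gamma> \<longlongrightarrow> l) (at_left 1)" by blast
qed

definition approach :: "nat \<Rightarrow> real" where "approach n = 1 - 1 / (real n + 2)"

lemma approach_bounds: "0 < approach n" "approach n < 1"
  by (simp_all add: approach_def)

lemma filterlim_approach: "filterlim approach (at_left 1) sequentially"
proof (rule tendsto_imp_filterlim_at_left)
  show "approach \<longlonglongrightarrow> 1" unfolding approach_def by real_asymp
qed (simp add: approach_bounds)

lemma continuous_on_circle_dilate: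
  assumes g: "continuous_on unit_disk g" and "0 < s" "s < 1"
  shows "continuous_on unit_circle (\<lambda>\<zeta>. g (of_real s * \<zeta>))"
  by (intro continuous_on_compose2[OF g] continuous_intros) (use assms in \<open>auto simp: norm_mult\<close>)

text \<open>Without a limit, \<open>Lim\<close> is a description of an object with an unsatisfiable property. This value does not
depend on \<open>g\<close> or \<open>\<zeta>\<close>, which is what allows one constant to bound its logarithm later.\<close>

lemma radial_limit_no_limit:
  assumes "\<nexists>l. ((\<lambda>r. g (of_real r * \<zeta>)) \<longlongrightarrow> l) (at_left 1)"
  shows "radial_limit g \<zeta> = (THE l. False)"
proof -
  have "(\<lambda>l. ((\<lambda>r. g (of_real r * \<zeta>)) \<longlongrightarrow> l) (at_left 1)) = (\<lambda>_. False)"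
    using assms by (simp add: fun_eq_iff)
  then show ?thesis unfolding radial_limit_def Topological_Spaces.Lim_def by (rule arg_cong)
qed

text \<open>On the Borel set \<open>C\<close> of points where the limit exists it is a limit along a fixed sequence of radii, hence
measurable there; off \<open>C\<close> the radial limit is constant.\<close>

lemma borel_measurable_radial_limit:
  assumes g: "continuous_on unit_disk g"
  shows "radial_limit g \<in> borel_measurable (restrict_space borel unit_circle)"
proof -
  define I where "I N = {1 - 1 / (real N + 1)<..<1}" for N :: nat
  have I: "0 < s" "s < 1" if "s \<in> I N" for s N
  proof -
    have "1 / (real N + 1) \<le> 1" by simp
    with that show "0 < s" "s < 1" unfolding I_def by (auto simp del: divide_le_eq_1 divide_le_eq_1_pos)
  qed
  define E where "E k N = {\<zeta> \<in> unit_circle. \<forall>s\<in>I N. \<forall>t\<in>I N.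
      dist (g (of_real s * \<zeta>)) (g (of_real t * \<zeta>)) \<le> 1 / (real k + 1)}" for k N :: nat
  have closed: "closed (E k N)" for k N
  proof -
    have "E k N = unit_circle \<inter> (\<Inter>s\<in>I N. \<Inter>t\<in>I N. {\<zeta> \<in> unit_circle.
        dist (g (of_real s * \<zeta>)) (g (of_real t * \<zeta>)) \<le> 1 / (real k + 1)})"
      unfolding E_def by blast
    also have "closed \<dots>"
    proof (intro closed_Int closed_INT ballI closed_sphere)
      fix s t assume "s \<in> I N" "t \<in> I N"
      then show "closed {\<zeta> \<in> unit_circle. dist (g (of_real s * \<zeta>)) (g (of_real t * \<zeta>)) \<le> 1 / (real k + 1)}"
        by (intro continuous_on_closed_Collect_le continuous_intros continuous_on_circle_dilate[OF g] I closed_sphere)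
    qed
    finally show ?thesis .
  qed
  define C where "C = (\<Inter>k. \<Union>N. E k N)"
  have C_iff: "\<zeta> \<in> C \<longleftrightarrow> (\<exists>l. ((\<lambda>r. g (of_real r * \<zeta>)) \<longlongrightarrow> l) (at_left 1))" if "\<zeta> \<in> unit_circle" for \<zeta>
    unfolding left_limit_iff_Cauchy C_def E_def I_def using that by blast
  have "C \<in> sets borel"
    unfolding C_def by (intro sets.countable_INT'' sets.countable_UN'') (auto intro: borel_closed closed)
  have eq: "radial_limit g \<zeta> = (if \<zeta> \<in> C then lim (\<lambda>n. g (of_real (approach n) * \<zeta>)) else (THE l. False))"
    if \<zeta>: "\<zeta> \<in> unit_circle" for \<zeta>
  proof (cases "\<zeta> \<in> C")
    case True
    then obtain l where l: "((\<lambda>r. g (of_real r * \<zeta>)) \<longlongrightarrow> l) (at_left 1)" using C_iff[OF \<zeta>] by blast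
    have "radial_limit g \<zeta> = l" unfolding radial_limit_def using l by (intro tendsto_Lim) simp_all
    moreover have "lim (\<lambda>n. g (of_real (approach n) * \<zeta>)) = l"
      by (rule limI) (rule filterlim_compose[OF l filterlim_approach])
    ultimately show ?thesis using True by simp
  next
    case False
    then have "\<nexists>l. ((\<lambda>r. g (of_real r * \<zeta>)) \<longlongrightarrow> l) (at_left 1)" using C_iff[OF \<zeta>] by blast
    from radial_limit_no_limit[OF this] show ?thesis using False by (simp only: if_False)
  qed
  have "(\<lambda>\<zeta>. if \<zeta> \<in> C then lim (\<lambda>n. g (of_real (approach n) * \<zeta>)) else (THE l. False))
      \<in> borel_measurable (restrict_space borel unit_circle)"
  proof (intro measurable_If borel_measurable_lim_metric borel_measurable_const)
    show "(\<lambda>\<zeta>. g (of_real (approach n) * \<zeta>)) \<in> borel_measurable (restrict_space borel unit_circle)" for n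
      by (intro borel_measurable_continuous_on_restrict continuous_on_circle_dilate[OF g] approach_bounds)
    show "{\<zeta> \<in> space (restrict_space borel unit_circle). \<zeta> \<in> C} \<in> sets (restrict_space borel unit_circle)"
    proof -
      have "{\<zeta> \<in> space (restrict_space borel unit_circle). \<zeta> \<in> C} = unit_circle \<inter> C"
        unfolding space_restrict_space by auto
      then show ?thesis using \<open>C \<in> sets borel\<close> unfolding sets_restrict_space by blast
    qed
  qed
  then show ?thesis
  proof (rule measurable_cong[THEN iffD2, rotated])
    fix \<zeta> assume "\<zeta> \<in> space (restrict_space borel unit_circle)"
    then have "\<zeta> \<in> unit_circle" by (simp only: space_restrict_space Int_iff)
    then show "radial_limit g \<zeta> = (if \<zeta> \<in> C then lim (\<lambda>n. g (of_real (approach n) * \<zeta>)) else (THE l. False))"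
      by (rule eq)
  qed
qed

section \<open>Poisson integrals along Schur functions\<close>

lemma Re_Herglotz_kernel:
  fixes w \<zeta> :: complex
  shows "Re ((\<zeta> + w) / (\<zeta> - w)) = ((norm \<zeta>)\<^sup>2 - (norm w)\<^sup>2) / (norm (\<zeta> - w))\<^sup>2"
proof -
  have "(\<zeta> + w) / (\<zeta> - w) = ((\<zeta> + w) * cnj (\<zeta> - w)) / of_real ((norm (\<zeta> - w))\<^sup>2)"
    using complex_div_cnj[of "\<zeta> + w" "\<zeta> - w"] by (simp only: of_real_power)
  then have "Re ((\<zeta> + w) / (\<zeta> - w)) = Re ((\<zeta> + w) * cnj (\<zeta> - w)) / (norm (\<zeta> - w))\<^sup>2"
    by (simp only: Re_divide_of_real)
  also have "Re ((\<zeta> + w) * cnj (\<zeta> - w)) = (norm \<zeta>)\<^sup>2 - (norm w)\<^sup>2"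
    unfolding cmod_power2 by (simp add: algebra_simps power2_eq_square)
  finally show ?thesis .
qed

text \<open>The Poisson kernel as the real part of the Herglotz kernel, with total mass \<open>2 * pi\<close> because arc length is
not normalised.\<close>

definition poisson :: "complex \<Rightarrow> complex \<Rightarrow> real" where
  "poisson w \<zeta> = Re ((\<zeta> + w) / (\<zeta> - w))"

lemma poisson_nonneg: "norm w < 1 \<Longrightarrow> norm \<zeta> = 1 \<Longrightarrow> 0 \<le> poisson w \<zeta>"
  by (simp add: poisson_def Re_Herglotz_kernel power_le_one)

lemma poisson_le: "norm w < 1 \<Longrightarrow> norm \<zeta> = 1 \<Longrightarrow> poisson w \<zeta> \<le> 2 / (1 - norm w)"
  unfolding poisson_def by (rule order_trans[OF complex_Re_le_cmod Herglotz_kernel_bound])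

lemma continuous_on_Herglotz_kernel:
  "norm w < 1 \<Longrightarrow> continuous_on unit_circle (\<lambda>\<zeta>. (\<zeta> + w) / (\<zeta> - w))"
  by (intro continuous_intros) auto

lemma integrable_Herglotz_kernel_mult:
  fixes h :: "complex \<Rightarrow> real"
  assumes w: "norm w < 1" and h: "integrable arc_measure h"
  shows "integrable arc_measure (\<lambda>\<zeta>. (\<zeta> + w) / (\<zeta> - w) * of_real (h \<zeta>))"
proof (rule Bochner_Integration.integrable_bound)
  show "integrable arc_measure (\<lambda>\<zeta>. 2 / (1 - norm w) * h \<zeta>)" using h by simp
  have "(\<lambda>\<zeta>. (\<zeta> + w) / (\<zeta> - w)) \<in> borel_measurable arc_measure"
    by (intro continuous_borel_measurable_arc_measure continuous_on_Herglotz_kernel w)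
  then show "(\<lambda>\<zeta>. (\<zeta> + w) / (\<zeta> - w) * of_real (h \<zeta>)) \<in> borel_measurable arc_measure"
    using borel_measurable_integrable[OF h] by measurable
  show "AE \<zeta> in arc_measure. norm ((\<zeta> + w) / (\<zeta> - w) * of_real (h \<zeta>)) \<le> norm (2 / (1 - norm w) * h \<zeta>)"
  proof (rule AE_I2)
    fix \<zeta> assume "\<zeta> \<in> space arc_measure"
    then have "norm ((\<zeta> + w) / (\<zeta> - w)) \<le> 2 / (1 - norm w)" using w by (intro Herglotz_kernel_bound) simp_all
    then have "norm ((\<zeta> + w) / (\<zeta> - w)) * \<bar>h \<zeta>\<bar> \<le> 2 / (1 - norm w) * \<bar>h \<zeta>\<bar>"
      by (rule mult_right_mono) simp
    then show "norm ((\<zeta> + w) / (\<zeta> - w) * of_real (h \<zeta>)) \<le> norm (2 / (1 - norm w) * h \<zeta>)"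
      using w by (simp only: norm_mult norm_of_real real_norm_def abs_mult) simp
  qed
qed

lemma
  fixes h :: "complex \<Rightarrow> real"
  assumes w: "norm w < 1" and h: "integrable arc_measure h"
  shows integrable_poisson_mult: "integrable arc_measure (\<lambda>\<zeta>. poisson w \<zeta> * h \<zeta>)"
    and integral_poisson_mult: "(\<integral>\<zeta>. poisson w \<zeta> * h \<zeta> \<partial>arc_measure)
      = Re (\<integral>\<zeta>. (\<zeta> + w) / (\<zeta> - w) * of_real (h \<zeta>) \<partial>arc_measure)"
proof -
  have "poisson w \<zeta> * h \<zeta> = Re ((\<zeta> + w) / (\<zeta> - w) * of_real (h \<zeta>))" for \<zeta>
    unfolding poisson_def
    by (simp only: times_complex.sel Re_complex_of_real Im_complex_of_real mult_zero_right diff_0_right)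
  then show "integrable arc_measure (\<lambda>\<zeta>. poisson w \<zeta> * h \<zeta>)"
    and "(\<integral>\<zeta>. poisson w \<zeta> * h \<zeta> \<partial>arc_measure)
      = Re (\<integral>\<zeta>. (\<zeta> + w) / (\<zeta> - w) * of_real (h \<zeta>) \<partial>arc_measure)"
    using integrable_Herglotz_kernel_mult[OF w h] by simp_all
qed

text \<open>The Schwarz formula for the constant function \<open>1\<close>.\<close>

lemma integral_poisson:
  assumes w: "norm w < 1"
  shows "(\<integral>\<zeta>. poisson w \<zeta> \<partial>arc_measure) = 2 * pi"
proof -
  have "(\<integral>\<zeta>. poisson w \<zeta> * 1 \<partial>arc_measure)
      = Re (\<integral>\<zeta>. (\<zeta> + w) / (\<zeta> - w) * of_real (Re 1) \<partial>arc_measure)"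
    by (subst integral_poisson_mult[OF w]) (simp_all add: integrable_arc_measure_continuous)
  also have "\<dots> = 2 * pi"
    by (subst Schwarz_integral_formula[OF _ _ w]) simp_all
  finally show ?thesis by simp
qed

text \<open>The Poisson integral of a nonnegative function with values in the extended reals, where Tonelli and
Fatou apply without any integrability condition.\<close>

definition poisson_nn :: "(complex \<Rightarrow> real) \<Rightarrow> complex \<Rightarrow> ennreal" where
  "poisson_nn e w = (\<integral>\<^sup>+\<zeta>. ennreal (poisson w \<zeta>) * ennreal (e \<zeta>) \<partial>arc_measure)"

lemma poisson_nn_eq:
  assumes w: "norm w < 1" and e: "integrable arc_measure e" and "\<And>\<zeta>. 0 \<le> e \<zeta>"
  shows "poisson_nn e w = ennreal (\<integral>\<zeta>. poisson w \<zeta> * e \<zeta> \<partial>arc_measure)"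
proof -
  have "poisson_nn e w = (\<integral>\<^sup>+\<zeta>. ennreal (poisson w \<zeta> * e \<zeta>) \<partial>arc_measure)"
    unfolding poisson_nn_def using assms
    by (intro nn_integral_cong) (simp add: ennreal_mult poisson_nonneg)
  also have "\<dots> = ennreal (\<integral>\<zeta>. poisson w \<zeta> * e \<zeta> \<partial>arc_measure)"
    using assms by (intro nn_integral_eq_integral integrable_poisson_mult AE_I2) (simp_all add: poisson_nonneg)
  finally show ?thesis .
qed

text \<open>In its first argument the Poisson kernel is the real part of a holomorphic function. Composed with
\<open>\<phi>\<close> it remains one, so the mean value property applies.\<close>

lemma nn_integral_poisson_circle:
  assumes \<phi>: "continuous_on (cball 0 1) \<phi>" "\<phi> holomorphic_on ball 0 1"
    and im: "\<And>z. norm z \<le> 1 \<Longrightarrow> norm (\<phi> z) < 1" and \<zeta>: "norm \<zeta> = 1"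
  shows "(\<integral>\<^sup>+\<xi>. ennreal (poisson (\<phi> \<xi>) \<zeta>) \<partial>arc_measure) = ennreal (2 * pi * poisson (\<phi> 0) \<zeta>)"
proof -
  have ne: "\<zeta> - \<phi> z \<noteq> 0" if "norm z \<le> 1" for z using im[OF that] \<zeta> by auto
  define k where "k z = (\<zeta> + \<phi> z) / (\<zeta> - \<phi> z)" for z
  have kc: "continuous_on (cball 0 1) k"
    unfolding k_def by (intro continuous_intros \<phi>) (use ne in auto)
  have kh: "k holomorphic_on ball 0 1"
    unfolding k_def by (intro holomorphic_intros \<phi>) (use ne in auto)
  have ki: "integrable arc_measure k"
    by (intro integrable_arc_measure_continuous continuous_on_subset[OF kc]) auto
  have "(\<integral>\<^sup>+\<xi>. ennreal (poisson (\<phi> \<xi>) \<zeta>) \<partial>arc_measure) = (\<integral>\<^sup>+\<xi>. ennreal (Re (k \<xi>)) \<partial>arc_measure)"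
    by (simp add: poisson_def k_def)
  also have "\<dots> = ennreal (\<integral>\<xi>. Re (k \<xi>) \<partial>arc_measure)"
  proof (rule nn_integral_eq_integral)
    show "integrable arc_measure (\<lambda>\<xi>. Re (k \<xi>))" using ki by (rule integrable_Re)
    show "AE \<xi> in arc_measure. 0 \<le> Re (k \<xi>)"
    proof (rule AE_I2)
      fix \<xi> assume "\<xi> \<in> space arc_measure"
      then show "0 \<le> Re (k \<xi>)" using poisson_nonneg[OF im \<zeta>, of \<xi>] by (simp add: poisson_def k_def)
    qed
  qed
  also have "(\<integral>\<xi>. Re (k \<xi>) \<partial>arc_measure) = Re (\<integral>\<xi>. k \<xi> \<partial>arc_measure)" using ki by (rule integral_Re)
  also have "\<dots> = 2 * pi * poisson (\<phi> 0) \<zeta>"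
  proof -
    have "Re (2 * pi * x) = 2 * pi * Re x" for x :: complex by simp
    then show ?thesis unfolding mean_value_arc_measure[OF kc kh] by (simp only: k_def poisson_def)
  qed
  finally show ?thesis .
qed

lemma borel_measurable_poisson_pair:
  assumes \<phi>: "\<phi> \<in> borel_measurable arc_measure" and e: "e \<in> borel_measurable arc_measure"
  shows "(\<lambda>(\<xi>, \<zeta>). ennreal (poisson (\<phi> \<xi>) \<zeta>) * ennreal (e \<zeta>)) \<in> borel_measurable (arc_measure \<Otimes>\<^sub>M arc_measure)"
proof -
  note \<phi>[measurable] e[measurable]
  have [measurable]: "(\<lambda>\<zeta>. \<zeta>) \<in> borel_measurable arc_measure"
    by (intro continuous_borel_measurable_arc_measure continuous_on_id)
  have [measurable]: "Re \<in> borel_measurable borel"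
    by (intro borel_measurable_continuous_onI continuous_intros)
  show ?thesis unfolding poisson_def by measurable
qed

text \<open>The subordination estimate: after exchanging the order of integration, the inner integral is the value of
the kernel at \<open>\<phi> 0\<close>, and the kernel is at most \<open>2 / (1 - norm (\<phi> 0))\<close>.\<close>

lemma
  assumes \<phi>: "continuous_on (cball 0 1) \<phi>" "\<phi> holomorphic_on ball 0 1"
    and im: "\<And>z. norm z \<le> 1 \<Longrightarrow> norm (\<phi> z) < 1" and e: "e \<in> borel_measurable arc_measure"
  shows borel_measurable_poisson_nn: "(\<lambda>\<xi>. poisson_nn e (\<phi> \<xi>)) \<in> borel_measurable arc_measure"
    and nn_integral_poisson_nn_le: "(\<integral>\<^sup>+\<xi>. poisson_nn e (\<phi> \<xi>) \<partial>arc_measure)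
      \<le> ennreal (4 * pi / (1 - norm (\<phi> 0))) * (\<integral>\<^sup>+\<zeta>. ennreal (e \<zeta>) \<partial>arc_measure)"
proof -
  interpret finite_measure arc_measure by (rule finite_arc_measure)
  have sf: "sigma_finite_measure arc_measure" ..
  interpret pair_sigma_finite arc_measure arc_measure ..
  have \<phi>m: "\<phi> \<in> borel_measurable arc_measure"
    by (intro continuous_borel_measurable_arc_measure continuous_on_subset[OF \<phi>(1)]) auto
  note pm = borel_measurable_poisson_pair[OF \<phi>m e]
  show "(\<lambda>\<xi>. poisson_nn e (\<phi> \<xi>)) \<in> borel_measurable arc_measure"
    unfolding poisson_nn_def by (rule sigma_finite_measure.borel_measurable_nn_integral[OF sf pm])
  have "(\<integral>\<^sup>+\<xi>. poisson_nn e (\<phi> \<xi>) \<partial>arc_measure)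
      = (\<integral>\<^sup>+\<zeta>. (\<integral>\<^sup>+\<xi>. ennreal (poisson (\<phi> \<xi>) \<zeta>) * ennreal (e \<zeta>) \<partial>arc_measure) \<partial>arc_measure)"
    unfolding poisson_nn_def by (rule Fubini'[OF pm, symmetric])
  also have "\<dots> = (\<integral>\<^sup>+\<zeta>. ennreal (2 * pi * poisson (\<phi> 0) \<zeta>) * ennreal (e \<zeta>) \<partial>arc_measure)"
  proof (rule nn_integral_cong)
    fix \<zeta> assume "\<zeta> \<in> space arc_measure"
    then have \<zeta>: "norm \<zeta> = 1" by simp
    have "\<zeta> - \<phi> \<xi> \<noteq> 0" if "\<xi> \<in> unit_circle" for \<xi> using im[of \<xi>] \<zeta> that by auto
    moreover have "continuous_on unit_circle \<phi>" by (rule continuous_on_subset[OF \<phi>(1)]) auto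
    ultimately have "continuous_on unit_circle (\<lambda>\<xi>. poisson (\<phi> \<xi>) \<zeta>)"
      unfolding poisson_def by (intro continuous_intros ballI)
    then have "(\<lambda>\<xi>. ennreal (poisson (\<phi> \<xi>) \<zeta>)) \<in> borel_measurable arc_measure"
      by (intro measurable_compose[OF _ measurable_ennreal] continuous_borel_measurable_arc_measure)
    then have "(\<integral>\<^sup>+\<xi>. ennreal (poisson (\<phi> \<xi>) \<zeta>) * ennreal (e \<zeta>) \<partial>arc_measure)
        = (\<integral>\<^sup>+\<xi>. ennreal (poisson (\<phi> \<xi>) \<zeta>) \<partial>arc_measure) * ennreal (e \<zeta>)"
      by (rule nn_integral_multc)
    also have "(\<integral>\<^sup>+\<xi>. ennreal (poisson (\<phi> \<xi>) \<zeta>) \<partial>arc_measure) = ennreal (2 * pi * poisson (\<phi> 0) \<zeta>)"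
      using \<phi> im \<zeta> by (rule nn_integral_poisson_circle)
    finally show "(\<integral>\<^sup>+\<xi>. ennreal (poisson (\<phi> \<xi>) \<zeta>) * ennreal (e \<zeta>) \<partial>arc_measure)
        = ennreal (2 * pi * poisson (\<phi> 0) \<zeta>) * ennreal (e \<zeta>)" .
  qed
  also have "\<dots> \<le> (\<integral>\<^sup>+\<zeta>. ennreal (4 * pi / (1 - norm (\<phi> 0))) * ennreal (e \<zeta>) \<partial>arc_measure)"
  proof (intro nn_integral_mono mult_right_mono ennreal_leI)
    fix \<zeta> assume "\<zeta> \<in> space arc_measure"
    then have "poisson (\<phi> 0) \<zeta> \<le> 2 / (1 - norm (\<phi> 0))" using im[of 0] by (intro poisson_le) simp_all
    then have "2 * pi * poisson (\<phi> 0) \<zeta> \<le> 2 * pi * (2 / (1 - norm (\<phi> 0)))" by (rule mult_left_mono) simp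
    then show "2 * pi * poisson (\<phi> 0) \<zeta> \<le> 4 * pi / (1 - norm (\<phi> 0))" by simp
  qed simp
  also have "\<dots> = ennreal (4 * pi / (1 - norm (\<phi> 0))) * (\<integral>\<^sup>+\<zeta>. ennreal (e \<zeta>) \<partial>arc_measure)"
    using e by (intro nn_integral_cmult) simp
  finally show "(\<integral>\<^sup>+\<xi>. poisson_nn e (\<phi> \<xi>) \<partial>arc_measure)
      \<le> ennreal (4 * pi / (1 - norm (\<phi> 0))) * (\<integral>\<^sup>+\<zeta>. ennreal (e \<zeta>) \<partial>arc_measure)" .
qed

lemma log_norm_outer:
  assumes c: "norm c = 1" and h: "integrable arc_measure h" and w: "norm w < 1"
    and fw: "f w = c * exp ((LINT \<zeta>|arc_measure. (\<zeta> + w) / (\<zeta> - w) * of_real (h \<zeta>)) / of_real (2 * pi))"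
  shows "2 * pi * ln (norm (f w)) = (\<integral>\<zeta>. poisson w \<zeta> * h \<zeta> \<partial>arc_measure)"
proof -
  have "ln (norm (f w)) = Re ((LINT \<zeta>|arc_measure. (\<zeta> + w) / (\<zeta> - w) * of_real (h \<zeta>)) / of_real (2 * pi))"
    unfolding fw norm_mult c norm_exp_eq_Re by simp
  also have "\<dots> = (\<integral>\<zeta>. poisson w \<zeta> * h \<zeta> \<partial>arc_measure) / (2 * pi)"
    unfolding integral_poisson_mult[OF w h] by (rule Re_divide_of_real)
  finally show ?thesis by simp
qed

text \<open>The bounded part of \<open>h\<close> contributes at most \<open>K\<close> to \<open>\<bar>u\<bar>\<close>, because the Poisson kernel has mass \<open>2 * pi\<close>; the excess
contributes its Poisson integral. For \<open>\<bar>u\<bar> < K\<close> the left side is \<open>0\<close>, since \<open>ennreal\<close> truncates at \<open>0\<close>.\<close>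

lemma abs_log_norm_outer_le:
  assumes h: "integrable arc_measure h" and w: "norm w < 1"
    and u: "2 * pi * u = (\<integral>\<zeta>. poisson w \<zeta> * h \<zeta> \<partial>arc_measure)"
  shows "ennreal (2 * pi * (\<bar>u\<bar> - K)) \<le> poisson_nn (\<lambda>\<zeta>. max 0 (\<bar>h \<zeta>\<bar> - K)) w"
proof -
  interpret finite_measure arc_measure by (rule finite_arc_measure)
  define e where "e \<zeta> = max 0 (\<bar>h \<zeta>\<bar> - K)" for \<zeta>
  have e: "integrable arc_measure e"
    unfolding e_def by (intro integrable_max Bochner_Integration.integrable_diff integrable_abs h) simp_all
  have e0: "0 \<le> e \<zeta>" for \<zeta> by (simp add: e_def)
  have pi1: "integrable arc_measure (\<lambda>\<zeta>. poisson w \<zeta> * K)"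
    by (rule integrable_poisson_mult[OF w]) simp
  have pe: "integrable arc_measure (\<lambda>\<zeta>. poisson w \<zeta> * e \<zeta>)" by (rule integrable_poisson_mult[OF w e])
  have "2 * pi * \<bar>u\<bar> = \<bar>\<integral>\<zeta>. poisson w \<zeta> * h \<zeta> \<partial>arc_measure\<bar>"
    unfolding u[symmetric] by (simp add: abs_mult)
  also have "\<dots> \<le> (\<integral>\<zeta>. \<bar>poisson w \<zeta> * h \<zeta>\<bar> \<partial>arc_measure)" by (rule integral_abs_bound)
  also have "\<dots> \<le> (\<integral>\<zeta>. poisson w \<zeta> * K + poisson w \<zeta> * e \<zeta> \<partial>arc_measure)"
  proof (rule integral_mono)
    fix \<zeta> assume "\<zeta> \<in> space arc_measure"
    then have p0: "0 \<le> poisson w \<zeta>" using w by (intro poisson_nonneg) simp_all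
    have "\<bar>h \<zeta>\<bar> \<le> K + e \<zeta>" by (simp add: e_def)
    then have "poisson w \<zeta> * \<bar>h \<zeta>\<bar> \<le> poisson w \<zeta> * (K + e \<zeta>)" using p0 by (rule mult_left_mono)
    then show "\<bar>poisson w \<zeta> * h \<zeta>\<bar> \<le> poisson w \<zeta> * K + poisson w \<zeta> * e \<zeta>"
      using p0 by (simp add: abs_mult distrib_left)
  qed (intro integrable_abs Bochner_Integration.integrable_add integrable_poisson_mult w h e pi1)+
  also have "\<dots> = 2 * pi * K + (\<integral>\<zeta>. poisson w \<zeta> * e \<zeta> \<partial>arc_measure)"
    unfolding Bochner_Integration.integral_add[OF pi1 pe] integral_mult_left_zero integral_poisson[OF w] ..
  finally have "2 * pi * (\<bar>u\<bar> - K) \<le> (\<integral>\<zeta>. poisson w \<zeta> * e \<zeta> \<partial>arc_measure)"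
    by (simp add: right_diff_distrib)
  then have "ennreal (2 * pi * (\<bar>u\<bar> - K)) \<le> poisson_nn e w"
    unfolding poisson_nn_eq[OF w e e0] by (rule ennreal_leI)
  then show ?thesis unfolding e_def .
qed

text \<open>Dominated convergence. The lower bound \<open>B\<close> leaves room to place \<open>K\<close> above the logarithm of
the default value of \<open>radial_limit\<close>.\<close>

lemma truncated_integral_small:
  fixes h :: "'a \<Rightarrow> real"
  assumes h: "integrable M h" and "e > 0"
  shows "\<exists>K. K \<ge> B \<and> (\<integral>\<^sup>+x. ennreal (max 0 (\<bar>h x\<bar> - K)) \<partial>M) \<le> ennreal e"
proof -
  have "(\<lambda>n. \<integral>x. max 0 (\<bar>h x\<bar> - real n) \<partial>M) \<longlonglongrightarrow> (\<integral>x. 0 \<partial>M)"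
  proof (rule integral_dominated_convergence[where w="\<lambda>x. \<bar>h x\<bar>"])
    show "AE x in M. (\<lambda>n. max 0 (\<bar>h x\<bar> - real n)) \<longlonglongrightarrow> 0"
    proof (rule AE_I2)
      fix x
      obtain N where N: "\<bar>h x\<bar> < real N" using reals_Archimedean2 by blast
      have "max 0 (\<bar>h x\<bar> - real n) = 0" if "n \<ge> N" for n using that N by simp
      then show "(\<lambda>n. max 0 (\<bar>h x\<bar> - real n)) \<longlonglongrightarrow> 0"
        by (intro tendsto_eventually) (auto simp: eventually_sequentially)
    qed
  qed (use h in auto)
  then have "\<forall>\<^sub>F n in sequentially. (\<integral>x. max 0 (\<bar>h x\<bar> - real n) \<partial>M) < e"
    using \<open>e > 0\<close> by (intro order_tendstoD) simp_all
  moreover have "\<forall>\<^sub>F n in sequentially. real n \<ge> max 0 B"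
    using filterlim_real_sequentially by (rule filterlim_at_top[THEN iffD1, rule_format])
  ultimately have "\<forall>\<^sub>F n in sequentially. (\<integral>x. max 0 (\<bar>h x\<bar> - real n) \<partial>M) < e \<and> real n \<ge> max 0 B"
    by (rule eventually_conj)
  then obtain n where n: "(\<integral>x. max 0 (\<bar>h x\<bar> - real n) \<partial>M) < e" "real n \<ge> max 0 B"
    by (auto dest: eventually_happens)
  have "(\<integral>\<^sup>+x. ennreal (max 0 (\<bar>h x\<bar> - real n)) \<partial>M) = ennreal (\<integral>x. max 0 (\<bar>h x\<bar> - real n) \<partial>M)"
  proof (rule nn_integral_eq_integral)
    show "integrable M (\<lambda>x. max 0 (\<bar>h x\<bar> - real n))"
      by (rule Bochner_Integration.integrable_bound[OF h]) (use h in auto)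
  qed simp
  also have "\<dots> \<le> ennreal e" using n by (intro ennreal_leI) simp
  finally show ?thesis using n(2) by (intro exI[of _ "real n"]) simp
qed

section \<open>Outer implies uniform integrability\<close>

text \<open>A bound along the radius passes to the boundary value. Where the radial limit exists and is nonzero this is
continuity of the logarithm. Everywhere else the boundary value of the logarithm is \<open>ln 0 = 0\<close> or the logarithm of the
default value, at most \<open>K\<close> in modulus, and the left side vanishes.\<close>

lemma log_boundary_le_liminf:
  fixes g :: "complex \<Rightarrow> complex" and V :: "nat \<Rightarrow> ennreal"
  assumes K: "\<bar>ln (norm (THE l::complex. False))\<bar> \<le> K" "0 \<le> K"
    and V: "\<And>n. ennreal (C * (\<bar>ln (norm (g (of_real (approach n) * \<zeta>)))\<bar> - K)) \<le> V n" and "C \<ge> 0"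
  shows "ennreal (C * (\<bar>ln (norm (radial_limit g \<zeta>))\<bar> - K)) \<le> liminf V"
proof (cases "\<exists>l. l \<noteq> 0 \<and> ((\<lambda>r. g (of_real r * \<zeta>)) \<longlongrightarrow> l) (at_left 1)")
  case True
  then obtain l where "l \<noteq> 0" and l: "((\<lambda>r. g (of_real r * \<zeta>)) \<longlongrightarrow> l) (at_left 1)" by blast
  have rl: "radial_limit g \<zeta> = l" unfolding radial_limit_def using l by (intro tendsto_Lim) simp_all
  have "(\<lambda>n. g (of_real (approach n) * \<zeta>)) \<longlonglongrightarrow> l" by (rule filterlim_compose[OF l filterlim_approach])
  then have "(\<lambda>n. ennreal (C * (\<bar>ln (norm (g (of_real (approach n) * \<zeta>)))\<bar> - K)))
      \<longlonglongrightarrow> ennreal (C * (\<bar>ln (norm l)\<bar> - K))"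
    using \<open>l \<noteq> 0\<close>
    by (intro tendsto_ennrealI tendsto_mult tendsto_diff tendsto_const tendsto_rabs tendsto_ln tendsto_norm)
       simp_all
  then have "ennreal (C * (\<bar>ln (norm l)\<bar> - K))
      = liminf (\<lambda>n. ennreal (C * (\<bar>ln (norm (g (of_real (approach n) * \<zeta>)))\<bar> - K)))"
    by (rule lim_imp_Liminf[symmetric, rotated]) simp
  also have "\<dots> \<le> liminf V" by (intro Liminf_mono always_eventually allI V)
  finally show ?thesis unfolding rl .
next
  case False
  have "radial_limit g \<zeta> = 0 \<or> radial_limit g \<zeta> = (THE l. False)"
  proof (cases "\<exists>l. ((\<lambda>r. g (of_real r * \<zeta>)) \<longlongrightarrow> l) (at_left 1)")
    case True
    then obtain l where l: "((\<lambda>r. g (of_real r * \<zeta>)) \<longlongrightarrow> l) (at_left 1)" ..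
    have "l = 0"
    proof (rule ccontr)
      assume "l \<noteq> 0"
      with l have "\<exists>l. l \<noteq> 0 \<and> ((\<lambda>r. g (of_real r * \<zeta>)) \<longlongrightarrow> l) (at_left 1)" by (intro exI conjI)
      with False show False ..
    qed
    with l have "((\<lambda>r. g (of_real r * \<zeta>)) \<longlongrightarrow> 0) (at_left 1)" by (simp only:)
    then have "radial_limit g \<zeta> = 0" unfolding radial_limit_def by (intro tendsto_Lim) simp_all
    then show ?thesis ..
  next
    case False
    from radial_limit_no_limit[OF this] show ?thesis ..
  qed
  then have "\<bar>ln (norm (radial_limit g \<zeta>))\<bar> \<le> K"
  proof
    assume "radial_limit g \<zeta> = 0"
    then show ?thesis using K(2) by simp
  next
    assume eq: "radial_limit g \<zeta> = (THE l. False)"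
    show ?thesis unfolding eq by (rule K(1))
  qed
  then have "C * (\<bar>ln (norm (radial_limit g \<zeta>))\<bar> - K) \<le> 0"
    using \<open>C \<ge> 0\<close> by (intro mult_nonneg_nonpos) simp_all
  then have "ennreal (C * (\<bar>ln (norm (radial_limit g \<zeta>))\<bar> - K)) = 0" by (rule ennreal_neg)
  then show ?thesis by (simp only: zero_le)
qed

text \<open>Where \<open>\<bar>g x\<bar> \<ge> 2 * K\<close>, the excess of \<open>\<bar>g x\<bar>\<close> over \<open>K\<close> is at least half of \<open>\<bar>g x\<bar>\<close>.\<close>

lemma tail_integral_le:
  fixes g :: "'a \<Rightarrow> real"
  assumes g: "g \<in> borel_measurable M" and K: "0 \<le> K" "2 * K \<le> t"
  shows "(\<integral>\<^sup>+x\<in>{x \<in> space M. norm (g x) \<ge> t}. ennreal (norm (g x)) \<partial>M)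
    \<le> ennreal (1 / pi) * (\<integral>\<^sup>+x. ennreal (2 * pi * (\<bar>g x\<bar> - K)) \<partial>M)"
proof -
  have "(\<integral>\<^sup>+x\<in>{x \<in> space M. norm (g x) \<ge> t}. ennreal (norm (g x)) \<partial>M)
      \<le> (\<integral>\<^sup>+x. ennreal (1 / pi) * ennreal (2 * pi * (\<bar>g x\<bar> - K)) \<partial>M)"
  proof (rule nn_integral_mono)
    fix x assume "x \<in> space M"
    show "ennreal (norm (g x)) * indicator {x \<in> space M. norm (g x) \<ge> t} x
        \<le> ennreal (1 / pi) * ennreal (2 * pi * (\<bar>g x\<bar> - K))"
    proof (cases "\<bar>g x\<bar> \<ge> t")
      case True
      then have "\<bar>g x\<bar> \<le> 2 * (\<bar>g x\<bar> - K)" using K by simp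
      also have "\<dots> = 1 / pi * (2 * pi * (\<bar>g x\<bar> - K))" by simp
      finally have "ennreal \<bar>g x\<bar> \<le> ennreal (1 / pi * (2 * pi * (\<bar>g x\<bar> - K)))" by (rule ennreal_leI)
      also have "\<dots> = ennreal (1 / pi) * ennreal (2 * pi * (\<bar>g x\<bar> - K))" by (rule ennreal_mult') simp
      finally show ?thesis using True \<open>x \<in> space M\<close> by simp
    qed simp
  qed
  also have "\<dots> = ennreal (1 / pi) * (\<integral>\<^sup>+x. ennreal (2 * pi * (\<bar>g x\<bar> - K)) \<partial>M)"
    using g by (intro nn_integral_cmult) simp
  finally show ?thesis .
qed

text \<open>With \<open>\<phi> n z = \<psi> (approach n * z)\<close> the subordination estimate holds on the closed disk. Its constant involves only
\<open>norm (\<phi> n 0) = norm (\<psi> 0) \<le> a\<close>, so it is uniform in \<open>n\<close> and in \<open>\<psi>\<close>.\<close>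

lemma uniformly_integrable_if_outer:
  assumes "outer f" and a: "0 \<le> a" "a < 1"
  shows "uniformly_integrable arc_measure
      ((\<lambda>\<psi> \<zeta>. ln (norm (radial_limit (f \<circ> \<psi>) \<zeta>))) ` schur_class_le a)"
proof -
  from \<open>outer f\<close> obtain c \<rho> where hol: "f holomorphic_on unit_disk" and c: "norm c = 1"
    and int: "integrable arc_measure (\<lambda>\<zeta>. ln (\<rho> \<zeta>))"
    and f: "\<And>z. z \<in> unit_disk \<Longrightarrow> f z = c * exp ((LINT \<zeta>|arc_measure. (\<zeta> + z) / (\<zeta> - z) * of_real (ln (\<rho> \<zeta>)))
                          / of_real (2 * pi))"
    unfolding outer_def by blast
  define h where "h \<zeta> = ln (\<rho> \<zeta>)" for \<zeta>
  have h: "integrable arc_measure h" unfolding h_def by (rule int)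
  define g where "g \<psi> \<zeta> = ln (norm (radial_limit (f \<circ> \<psi>) \<zeta>))" for \<psi> \<zeta>
  have bound: "ennreal (2 * pi * (\<bar>ln (norm (f w))\<bar> - K)) \<le> poisson_nn (\<lambda>\<zeta>. max 0 (\<bar>h \<zeta>\<bar> - K)) w"
    if "norm w < 1" for w K
    by (rule abs_log_norm_outer_le[OF h that log_norm_outer[OF c h that]]) (use f that in \<open>simp add: h_def\<close>)
  have gm: "g \<psi> \<in> borel_measurable arc_measure" if "\<psi> \<in> schur_class_le a" for \<psi>
  proof -
    have "\<psi> holomorphic_on unit_disk" "\<psi> ` unit_disk \<subseteq> unit_disk"
      using that by (simp_all add: schur_class_le_def schur_class_def)
    then have "continuous_on unit_disk (f \<circ> \<psi>)"
      by (intro continuous_on_compose holomorphic_on_imp_continuous_on holomorphic_on_subset[OF hol])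
    from borel_measurable_arc_measure[OF borel_measurable_radial_limit[OF this]]
    show ?thesis unfolding g_def by measurable
  qed
  have main: "(\<integral>\<^sup>+\<zeta>. ennreal (2 * pi * (\<bar>g \<psi> \<zeta>\<bar> - K)) \<partial>arc_measure)
      \<le> ennreal (4 * pi / (1 - a)) * (\<integral>\<^sup>+\<zeta>. ennreal (max 0 (\<bar>h \<zeta>\<bar> - K)) \<partial>arc_measure)"
    if \<psi>: "\<psi> \<in> schur_class_le a" and K: "\<bar>ln (norm (THE l::complex. False))\<bar> \<le> K" for \<psi> K
  proof -
    define e where "e \<zeta> = max 0 (\<bar>h \<zeta>\<bar> - K)" for \<zeta>
    have em: "e \<in> borel_measurable arc_measure"
      unfolding e_def using borel_measurable_integrable[OF h] by measurable
    have \<psi>hol: "\<psi> holomorphic_on unit_disk" and \<psi>im: "\<And>z. norm z < 1 \<Longrightarrow> norm (\<psi> z) < 1" and \<psi>0: "norm (\<psi> 0) \<le> a"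
      using \<psi> by (auto simp: schur_class_le_def schur_class_def image_subset_iff)
    define \<phi> where "\<phi> n z = \<psi> (of_real (approach n) * z)" for n z
    have in_disk: "norm (of_real (approach n) * z) < 1" if "norm z \<le> 1" for n and z :: complex
    proof -
      have "approach n * norm z \<le> approach n" using approach_bounds[of n] that by (intro mult_left_le) simp_all
      moreover have "norm (of_real (approach n) * z) = approach n * norm z"
        using approach_bounds[of n] by (simp add: norm_mult)
      ultimately show ?thesis using approach_bounds[of n] by linarith
    qed
    have \<phi>c: "continuous_on (cball 0 1) (\<phi> n)" for n
      unfolding \<phi>_def
      by (intro continuous_on_compose2[OF holomorphic_on_imp_continuous_on[OF \<psi>hol]] continuous_intros)
         (use in_disk in auto)
    have \<phi>h: "\<phi> n holomorphic_on ball 0 1" for n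
      unfolding \<phi>_def
      by (intro holomorphic_on_compose_gen[OF _ \<psi>hol, unfolded o_def] holomorphic_intros) (use in_disk in auto)
    have \<phi>im: "norm (\<phi> n z) < 1" if "norm z \<le> 1" for n z
      unfolding \<phi>_def by (intro \<psi>im in_disk that)
    have "(\<integral>\<^sup>+\<zeta>. ennreal (2 * pi * (\<bar>g \<psi> \<zeta>\<bar> - K)) \<partial>arc_measure)
        \<le> (\<integral>\<^sup>+\<zeta>. liminf (\<lambda>n. poisson_nn e (\<phi> n \<zeta>)) \<partial>arc_measure)"
    proof (rule nn_integral_mono)
      fix \<zeta> assume "\<zeta> \<in> space arc_measure"
      then have \<zeta>: "norm \<zeta> \<le> 1" by simp
      have "ennreal (2 * pi * (\<bar>ln (norm ((f \<circ> \<psi>) (of_real (approach n) * \<zeta>)))\<bar> - K))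
          \<le> poisson_nn e (\<phi> n \<zeta>)" for n
        using bound[OF \<phi>im[OF \<zeta>], of n K] unfolding e_def \<phi>_def by simp
      then show "ennreal (2 * pi * (\<bar>g \<psi> \<zeta>\<bar> - K)) \<le> liminf (\<lambda>n. poisson_nn e (\<phi> n \<zeta>))"
        unfolding g_def using K by (intro log_boundary_le_liminf) simp_all
    qed
    also have "\<dots> \<le> liminf (\<lambda>n. \<integral>\<^sup>+\<zeta>. poisson_nn e (\<phi> n \<zeta>) \<partial>arc_measure)"
      using \<phi>c \<phi>h \<phi>im em by (intro nn_integral_liminf borel_measurable_poisson_nn)
    also have "\<dots> \<le> liminf (\<lambda>n. ennreal (4 * pi / (1 - a)) * (\<integral>\<^sup>+\<zeta>. ennreal (e \<zeta>) \<partial>arc_measure))"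
    proof (intro Liminf_mono always_eventually allI)
      fix n
      have "(\<integral>\<^sup>+\<zeta>. poisson_nn e (\<phi> n \<zeta>) \<partial>arc_measure)
          \<le> ennreal (4 * pi / (1 - norm (\<phi> n 0))) * (\<integral>\<^sup>+\<zeta>. ennreal (e \<zeta>) \<partial>arc_measure)"
        using \<phi>c \<phi>h \<phi>im em by (intro nn_integral_poisson_nn_le)
      also have "\<dots> \<le> ennreal (4 * pi / (1 - a)) * (\<integral>\<^sup>+\<zeta>. ennreal (e \<zeta>) \<partial>arc_measure)"
        using \<psi>0 a by (intro mult_right_mono ennreal_leI divide_left_mono) (simp_all add: \<phi>_def)
      finally show "(\<integral>\<^sup>+\<zeta>. poisson_nn e (\<phi> n \<zeta>) \<partial>arc_measure)
          \<le> ennreal (4 * pi / (1 - a)) * (\<integral>\<^sup>+\<zeta>. ennreal (e \<zeta>) \<partial>arc_measure)" .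
    qed
    also have "\<dots> = ennreal (4 * pi / (1 - a)) * (\<integral>\<^sup>+\<zeta>. ennreal (e \<zeta>) \<partial>arc_measure)"
      by (rule Liminf_const) simp
    finally show ?thesis unfolding e_def .
  qed
  have "((\<lambda>t. SUP G\<in>g ` schur_class_le a. \<integral>\<^sup>+x\<in>{x \<in> space arc_measure. norm (G x) \<ge> t}. ennreal (norm (G x)) \<partial>arc_measure)
      \<longlongrightarrow> 0) at_top"
  proof (rule order_tendstoI)
    fix y :: ennreal assume "0 < y"
    then obtain \<epsilon> where \<epsilon>: "0 < ennreal \<epsilon>" "ennreal \<epsilon> < y" by (metis ennreal_cases dense less_top_ennreal order_less_trans top.not_eq_extremum)
    then have \<epsilon>0: "0 < \<epsilon>" by (simp add: ennreal_less_zero_iff)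
    \<comment> \<open>The constants below multiply to \<open>4 / (1 - a)\<close>.\<close>
    define \<delta> where "\<delta> = \<epsilon> * (1 - a) / 4"
    have "\<delta> > 0" using \<epsilon>0 a by (simp add: \<delta>_def)
    from truncated_integral_small[OF h this, of "\<bar>ln (norm (THE l::complex. False))\<bar>"] obtain K where
      K: "\<bar>ln (norm (THE l::complex. False))\<bar> \<le> K"
      and small: "(\<integral>\<^sup>+\<zeta>. ennreal (max 0 (\<bar>h \<zeta>\<bar> - K)) \<partial>arc_measure) \<le> ennreal \<delta>" by blast
    have K0: "0 \<le> K" using K by linarith
    \<comment> \<open>From level \<open>2 * K\<close> on, the tails are uniformly at most \<open>\<epsilon>\<close>.\<close>
    have "(SUP G\<in>g ` schur_class_le a. \<integral>\<^sup>+x\<in>{x \<in> space arc_measure. norm (G x) \<ge> t}. ennreal (norm (G x)) \<partial>arc_measure) \<le> ennreal \<epsilon>"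
      if t: "2 * K \<le> t" for t
    proof (rule SUP_least)
      fix G assume "G \<in> g ` schur_class_le a"
      then obtain \<psi> where \<psi>: "\<psi> \<in> schur_class_le a" and G: "G = g \<psi>" by blast
      have "(\<integral>\<^sup>+x\<in>{x \<in> space arc_measure. norm (G x) \<ge> t}. ennreal (norm (G x)) \<partial>arc_measure)
          \<le> ennreal (1 / pi) * (\<integral>\<^sup>+\<zeta>. ennreal (2 * pi * (\<bar>g \<psi> \<zeta>\<bar> - K)) \<partial>arc_measure)"
        unfolding G by (rule tail_integral_le[OF gm[OF \<psi>] K0 t])
      also have "\<dots> \<le> ennreal (1 / pi) * (ennreal (4 * pi / (1 - a)) * ennreal \<delta>)"
        by (intro mult_left_mono order_trans[OF main[OF \<psi> K]] small) simp_all
      also have "\<dots> = ennreal (1 / pi * (4 * pi / (1 - a) * \<delta>))"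
        using a \<open>\<delta> > 0\<close> by (subst ennreal_mult'[symmetric], simp)+ (rule refl)
      also have "1 / pi * (4 * pi / (1 - a) * \<delta>) = \<epsilon>" using a by (simp add: \<delta>_def)
      finally show "(\<integral>\<^sup>+x\<in>{x \<in> space arc_measure. norm (G x) \<ge> t}. ennreal (norm (G x)) \<partial>arc_measure) \<le> ennreal \<epsilon>" .
    qed
    then have "\<forall>\<^sub>F t in at_top. (SUP G\<in>g ` schur_class_le a. \<integral>\<^sup>+x\<in>{x \<in> space arc_measure. norm (G x) \<ge> t}. ennreal (norm (G x)) \<partial>arc_measure) \<le> ennreal \<epsilon>"
      using eventually_ge_at_top[of "2 * K"] by (rule eventually_mono[rotated])
    then show "\<forall>\<^sub>F t in at_top. (SUP G\<in>g ` schur_class_le a. \<integral>\<^sup>+x\<in>{x \<in> space arc_measure. norm (G x) \<ge> t}. ennreal (norm (G x)) \<partial>arc_measure) < y"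
      using \<epsilon>(2) by (elim eventually_mono) (rule order_le_less_trans)
  qed simp
  then have "uniformly_integrable arc_measure (g ` schur_class_le a)"
    unfolding uniformly_integrable_def using gm by blast
  then show ?thesis unfolding g_def .
qed

section \<open>The characterization\<close>

theorem theorem3:
  fixes f :: "complex \<Rightarrow> complex" and a :: real
  assumes "f \<in> nevanlinna_class"
    and "\<forall>z\<in>unit_disk. f z \<noteq> 0"
    and "0 \<le> a" and "a < 1"
  shows "outer f \<longleftrightarrow>
    uniformly_integrable arc_measure
      ((\<lambda>\<psi> \<zeta>. ln (norm (radial_limit (f \<circ> \<psi>) \<zeta>))) ` schur_class_le a)"
proof
  show "uniformly_integrable arc_measure
      ((\<lambda>\<psi> \<zeta>. ln (norm (radial_limit (f \<circ> \<psi>) \<zeta>))) ` schur_class_le a)" if "outer f"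
    using that assms(3,4) by (rule uniformly_integrable_if_outer)
next
  obtain f1 f2 where "f1 holomorphic_on unit_disk" "f2 holomorphic_on unit_disk"
    "\<forall>z\<in>unit_disk. f2 z \<noteq> 0" and q: "\<forall>z\<in>unit_disk. f z = f1 z / f2 z"
    using assms(1) by (auto simp: nevanlinna_class_def)
  then have "(\<lambda>z. f1 z / f2 z) holomorphic_on unit_disk" by (intro holomorphic_intros) auto
  then have "f holomorphic_on unit_disk" by (rule holomorphic_transform) (use q in simp)
  then show "outer f" if "uniformly_integrable arc_measure
      ((\<lambda>\<psi> \<zeta>. ln (norm (radial_limit (f \<circ> \<psi>) \<zeta>))) ` schur_class_le a)"
    using assms(2,3) that by (rule outer_if_uniformly_integrable)
qed

end
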